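(* Let $B=(\Lambda,M,C,{}^* )$ be a cellular algebra over a field $\mathbb F$, and assume that $B$ is quasi-hereditary, i.e. that the invariant form $\phi_\lambda$ on each cell module $W(\lambda)$ ($\lambda\in\Lambda$) is non-zero. Let $\mathcal R$ be the radical of $B$, and for $\lambda\in\Lambda$ let $R(\lambda)\subseteq W(\lambda)$ be the radical of $\phi_\lambda$ and $L(\lambda)=W(\lambda)/R(\lambda)$. \begin{enumerate} \item Let $\lambda\in\Lambda$ and take any elements $x\in W(\lambda)$, $z\in R(\lambda)$. Then there exist elements $r(x,z)\in C^\lambda(x\otimes z)+B(<\lambda)$ and $r(z,x)\in C^\lambda(z\otimes x)+B(<\lambda)$, both in $\mathcal R$. \item Let $X$ be a subset of $B$ such that for all $\lambda\in\Lambda$, $x\in W(\lambda)$ and $z\in R(\lambda)$, $X$ contains elements $r(x,z)$ and $r(z,x)$ as in (1) (i.e. $r(x,z)\in \mathcal R\cap(C^\lambda(x\otimes z)+B(<\lambda))$ and $r(z,x)\in\mathcal R\cap (C^\lambda(z\otimes x)+B(<\lambda))$). Then the linear subspace of $B$ spanned by $X$ contains $\mathcal R$. \item Suppose $J$ is a two-sided ideal of $B$ such that $J^*=J$. Let $\Lambda^0:=\{\lambda\in\Lambda\mid JL(\lambda)=0\}$. Then $J\supseteq\mathcal R$ if and only if, for all $\lambda\in\Lambda^0$, $R(\lambda)\subseteq JW(\lambda)$. \end{enumerate}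
   Context: A cellular algebra $B=(\Lambda,M,C,{}^* )$ over $\mathbb F$ (Graham–Lehrer) consists of a finite poset $\Lambda$, a finite set $M(\lambda)$ for each $\lambda\in\Lambda$, an $\mathbb F$-basis $\{C^\lambda_{S,T}\mid\lambda\in\Lambda,\ S,T\in M(\lambda)\}$ of $B$, and an algebra anti-involution ${}^*$ with $(C^\lambda_{S,T})^*=C^\lambda_{T,S}$, such that for $a\in B$, $aC^\lambda_{S,T}\equiv\sum_{S'\in M(\lambda)}r_a(S',S)C^\lambda_{S',T}\pmod{B(<\lambda)}$ with $r_a(S',S)\in\mathbb F$ independent of $T$. Here $B(<\lambda)$ (resp. $B(\leq\lambda)$) is the span of all $C^\mu_{U,V}$ with $\mu<\lambda$ (resp. $\mu\le\lambda$), a two-sided ideal. The cell module $W(\lambda)$ has basis $\{C_S\mid S\in M(\lambda)\}$ and action $aC_S=\sum_{S'}r_a(S',S)C_{S'}$. The bilinear form $\phi_\lambda$ on $W(\lambda)$ is defined by $C^\lambda_{S,T}C^\lambda_{U,V}\equiv\phi_\lambda(C_T,C_U)C^\lambda_{S,V}\pmod{B(<\lambda)}$; its radical $R(\lambda)=\{x\in W(\lambda)\mid \phi_\lambda(x,y)=0\ \forall y\in W(\lambda)\}$ is a submodule. The linear map $C^\lambda:W(\lambda)\otimes_{\mathbb F}W(\lambda)\to B$ is defined by $C^\lambda(C_S\otimes C_T)=C^\lambda_{S,T}$. For a left module $W$ and ideal $J$, $JW$ is the submodule spanned by all $aw$, $a\in J$, $w\in W$. *)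

theory Defs
  imports Complex_Main "HOL-Library.Function_Algebras" "HOL-Library.Set_Algebras"
begin

section \<open>Unital associative algebras over a field\<close>

text \<open>
  The algebra lives on a type of class \<open>ring\<close> (associative, not assumed unital), with the unit
  required by an axiom. Class \<open>ring_1\<close> would add \<open>0 \<noteq> 1\<close> and so exclude the zero algebra, which
  is cellular (with an empty poset).
\<close>

locale unital_algebra = vector_space sc
  for sc :: "'f::field \<Rightarrow> 'b::ring \<Rightarrow> 'b" +
  assumes scale_mult_left: "sc c a * b = sc c (a * b)"
    and scale_mult_right: "a * sc c b = sc c (a * b)"
    and unit_exists: "\<exists>e::'b. \<forall>a. e * a = a \<and> a * e = a"

definition left_ideal :: "('f::field \<Rightarrow> 'b::ring \<Rightarrow> 'b) \<Rightarrow> 'b set \<Rightarrow> bool" where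
  "left_ideal sc I \<longleftrightarrow> module.subspace sc I \<and> (\<forall>a. \<forall>x\<in>I. a * x \<in> I)"

definition two_sided_ideal :: "('f::field \<Rightarrow> 'b::ring \<Rightarrow> 'b) \<Rightarrow> 'b set \<Rightarrow> bool" where
  "two_sided_ideal sc I \<longleftrightarrow>
     module.subspace sc I \<and> (\<forall>a. \<forall>x\<in>I. a * x \<in> I \<and> x * a \<in> I)"

definition maximal_left_ideal :: "('f::field \<Rightarrow> 'b::ring \<Rightarrow> 'b) \<Rightarrow> 'b set \<Rightarrow> bool" where
  "maximal_left_ideal sc I \<longleftrightarrow> left_ideal sc I \<and> I \<noteq> UNIV \<and>
     (\<forall>K. left_ideal sc K \<and> I \<subseteq> K \<longrightarrow> K = I \<or> K = UNIV)"

text \<open>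
  The (Jacobson) radical. For the zero algebra the intersection is over the empty family and
  gives \<open>UNIV = {0}\<close>.
\<close>

definition jacobson_radical :: "('f::field \<Rightarrow> 'b::ring \<Rightarrow> 'b) \<Rightarrow> 'b set" where
  "jacobson_radical sc = \<Inter> {I. maximal_left_ideal sc I}"

section \<open>Cellular algebras\<close>

record ('f, 'b, 'l, 'm) cell_data =
  smul :: "'f \<Rightarrow> 'b \<Rightarrow> 'b"
  cpos :: "'l set"
  tab :: "'l \<Rightarrow> 'm set"
  cbas :: "'l \<Rightarrow> 'm \<Rightarrow> 'm \<Rightarrow> 'b"
  invol :: "'b \<Rightarrow> 'b"

text \<open>
  \<open>cpos\<close> is the poset \<open>\<Lambda>\<close>, with the order induced from the type \<open>'l\<close>; \<open>tab\<close> is \<open>M\<close>, \<open>cbas\<close> is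
  \<open>C\<close> and \<open>invol\<close> is \<open>*\<close>. Values of \<open>tab\<close> outside \<open>cpos\<close>, and of \<open>cbas\<close> outside the index sets,
  are irrelevant.
\<close>

definition cell_index ::
  "('f::field, 'b::ring, 'l::order, 'm) cell_data \<Rightarrow> ('l \<times> 'm \<times> 'm) set" where
  "cell_index B = {(l, S, T). l \<in> cpos B \<and> S \<in> tab B l \<and> T \<in> tab B l}"

definition B_less :: "('f::field, 'b::ring, 'l::order, 'm) cell_data \<Rightarrow> 'l \<Rightarrow> 'b set" where
  "B_less B l = module.span (smul B) {cbas B m U V | m U V. (m, U, V) \<in> cell_index B \<and> m < l}"

definition cell_coeffs ::
  "('f::field, 'b::ring, 'l::order, 'm) cell_data \<Rightarrow> 'l \<Rightarrow> 'b \<Rightarrow> ('m \<Rightarrow> 'm \<Rightarrow> 'f) \<Rightarrow> bool" where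
  "cell_coeffs B l a r \<longleftrightarrow> (\<forall>S\<in>tab B l. \<forall>T\<in>tab B l.
     a * cbas B l S T - (\<Sum>S'\<in>tab B l. smul B (r S' S) (cbas B l S' T)) \<in> B_less B l)"

locale cellular_algebra = unital_algebra "smul B"
  for B :: "('f::field, 'b::ring, 'l::order, 'm) cell_data" +
  assumes finite_poset: "finite (cpos B)"
    and finite_tab: "l \<in> cpos B \<Longrightarrow> finite (tab B l)"
    and basis_inj: "inj_on (\<lambda>(l, S, T). cbas B l S T) (cell_index B)"
    and basis_independent: "\<not> dependent ((\<lambda>(l, S, T). cbas B l S T) ` cell_index B)"
    and basis_span: "span ((\<lambda>(l, S, T). cbas B l S T) ` cell_index B) = UNIV"
    and invol_linear: "Vector_Spaces.linear (smul B) (smul B) (invol B)"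
    and invol_mult: "invol B (a * b) = invol B b * invol B a"
    and invol_invol: "invol B (invol B a) = a"
    and invol_basis: "(l, S, T) \<in> cell_index B \<Longrightarrow> invol B (cbas B l S T) = cbas B l T S"
    and cell_action: "l \<in> cpos B \<Longrightarrow> \<exists>r. cell_coeffs B l a r"

section \<open>Cell modules\<close>

text \<open>
  \<open>W(\<lambda>)\<close> is realised as the space of coordinate vectors: functions on \<open>'m\<close> vanishing outside
  \<open>M(\<lambda>)\<close>, with \<open>C\<^sub>S\<close> the indicator function of \<open>S\<close> and pointwise addition.
\<close>

definition fscale :: "'f::field \<Rightarrow> ('m \<Rightarrow> 'f) \<Rightarrow> 'm \<Rightarrow> 'f" where
  "fscale c x = (\<lambda>S. c * x S)"

definition cell_module :: "('f::field, 'b::ring, 'l::order, 'm) cell_data \<Rightarrow> 'l \<Rightarrow> ('m \<Rightarrow> 'f) set" where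
  "cell_module B l = {x. \<forall>S. S \<notin> tab B l \<longrightarrow> x S = 0}"

text \<open>
  \<open>act_coeff B l a S' S\<close> is \<open>r\<^sub>a(S', S)\<close>. For \<open>l \<in> \<Lambda>\<close> the coefficients exist by the cellularity
  axiom and are unique on \<open>M(\<lambda>) \<times> M(\<lambda>)\<close>; the values elsewhere are never used.
\<close>

definition act_coeff ::
  "('f::field, 'b::ring, 'l::order, 'm) cell_data \<Rightarrow> 'l \<Rightarrow> 'b \<Rightarrow> 'm \<Rightarrow> 'm \<Rightarrow> 'f" where
  "act_coeff B l a = (SOME r. cell_coeffs B l a r)"

definition cell_act ::
  "('f::field, 'b::ring, 'l::order, 'm) cell_data \<Rightarrow> 'l \<Rightarrow> 'b \<Rightarrow> ('m \<Rightarrow> 'f) \<Rightarrow> 'm \<Rightarrow> 'f" where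
  "cell_act B l a x =
     (\<lambda>S'. if S' \<in> tab B l then \<Sum>S\<in>tab B l. act_coeff B l a S' S * x S else 0)"

text \<open>
  \<open>gram B l T U\<close> is \<open>\<phi>(C\<^sub>T, C\<^sub>U)\<close>; existence and uniqueness of such a scalar (for \<open>l \<in> \<Lambda>\<close> and
  \<open>T, U \<in> M(\<lambda>)\<close>) is the standard lemma of Graham and Lehrer.
\<close>

definition gram :: "('f::field, 'b::ring, 'l::order, 'm) cell_data \<Rightarrow> 'l \<Rightarrow> 'm \<Rightarrow> 'm \<Rightarrow> 'f" where
  "gram B l T U = (SOME c. \<forall>S\<in>tab B l. \<forall>V\<in>tab B l.
     cbas B l S T * cbas B l U V - smul B c (cbas B l S V) \<in> B_less B l)"

definition cell_form ::
  "('f::field, 'b::ring, 'l::order, 'm) cell_data \<Rightarrow> 'l \<Rightarrow> ('m \<Rightarrow> 'f) \<Rightarrow> ('m \<Rightarrow> 'f) \<Rightarrow> 'f" where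
  "cell_form B l x y = (\<Sum>T\<in>tab B l. \<Sum>U\<in>tab B l. x T * y U * gram B l T U)"

definition cell_rad :: "('f::field, 'b::ring, 'l::order, 'm) cell_data \<Rightarrow> 'l \<Rightarrow> ('m \<Rightarrow> 'f) set" where
  "cell_rad B l = {x \<in> cell_module B l. \<forall>y\<in>cell_module B l. cell_form B l x y = 0}"

definition quasi_hereditary :: "('f::field, 'b::ring, 'l::order, 'm) cell_data \<Rightarrow> bool" where
  "quasi_hereditary B \<longleftrightarrow>
     (\<forall>l\<in>cpos B. \<exists>x\<in>cell_module B l. \<exists>y\<in>cell_module B l. cell_form B l x y \<noteq> 0)"

text \<open>
  \<open>W(\<lambda>) \<otimes> W(\<lambda>)\<close> is realised as functions on pairs, where \<open>C\<^sub>S \<otimes> C\<^sub>T\<close> is the indicator function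
  of \<open>(S, T)\<close>; \<open>cell_map\<close> is the linear map sending it to \<open>C\<^sub>S\<^sub>T\<close>.
\<close>

definition tensor :: "('m \<Rightarrow> 'f::field) \<Rightarrow> ('m \<Rightarrow> 'f) \<Rightarrow> 'm \<times> 'm \<Rightarrow> 'f"  (infixr \<open>\<otimes>\<close> 75) where
  "x \<otimes> y = (\<lambda>(S, T). x S * y T)"

definition cell_map ::
  "('f::field, 'b::ring, 'l::order, 'm) cell_data \<Rightarrow> 'l \<Rightarrow> ('m \<times> 'm \<Rightarrow> 'f) \<Rightarrow> 'b" where
  "cell_map B l t = (\<Sum>(S, T)\<in>tab B l \<times> tab B l. smul B (t (S, T)) (cbas B l S T))"

text \<open>
  \<open>J W(\<lambda>)\<close>. As \<open>J\<close> will be a left ideal, this linear span is a submodule.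
\<close>

definition ideal_cell_module ::
  "('f::field, 'b::ring, 'l::order, 'm) cell_data \<Rightarrow> 'b set \<Rightarrow> 'l \<Rightarrow> ('m \<Rightarrow> 'f) set" where
  "ideal_cell_module B J l =
     module.span fscale {cell_act B l a w | a w. a \<in> J \<and> w \<in> cell_module B l}"

section \<open>The quotients \<open>L(\<lambda>)\<close>\<close>

text \<open>
  Elements of \<open>L(\<lambda>) = W(\<lambda>)/R(\<lambda>)\<close> are the cosets \<open>x + R(\<lambda>)\<close>, with zero element \<open>R(\<lambda>)\<close> and
  addition the elementwise sum of sets.
\<close>

definition quot_module ::
  "('f::field, 'b::ring, 'l::order, 'm) cell_data \<Rightarrow> 'l \<Rightarrow> ('m \<Rightarrow> 'f) set set" where
  "quot_module B l = (\<lambda>x. x +o cell_rad B l) ` cell_module B l"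

definition quot_act ::
  "('f::field, 'b::ring, 'l::order, 'm) cell_data \<Rightarrow> 'l \<Rightarrow> 'b \<Rightarrow> ('m \<Rightarrow> 'f) set \<Rightarrow> ('m \<Rightarrow> 'f) set" where
  "quot_act B l a X = (\<Union>x\<in>X. cell_act B l a x +o cell_rad B l)"

definition quot_scale ::
  "('f::field, 'b::ring, 'l::order, 'm) cell_data \<Rightarrow> 'l \<Rightarrow> 'f \<Rightarrow> ('m \<Rightarrow> 'f) set \<Rightarrow> ('m \<Rightarrow> 'f) set" where
  "quot_scale B l c X = (\<Union>x\<in>X. fscale c x +o cell_rad B l)"

text \<open>
  \<open>J L(\<lambda>)\<close>, the linear span in \<open>L(\<lambda>)\<close> of all \<open>a X\<close>. It is defined inductively because the
  library's span is available for type-based vector spaces only.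
\<close>

inductive_set ideal_quot_module ::
  "('f::field, 'b::ring, 'l::order, 'm) cell_data \<Rightarrow> 'b set \<Rightarrow> 'l \<Rightarrow> ('m \<Rightarrow> 'f) set set"
  for B :: "('f::field, 'b::ring, 'l::order, 'm) cell_data" and J :: "'b set" and l :: 'l where
  zero: "cell_rad B l \<in> ideal_quot_module B J l"
| act: "a \<in> J \<Longrightarrow> X \<in> quot_module B l \<Longrightarrow> quot_act B l a X \<in> ideal_quot_module B J l"
| add: "X \<in> ideal_quot_module B J l \<Longrightarrow> Y \<in> ideal_quot_module B J l \<Longrightarrow>
    X + Y \<in> ideal_quot_module B J l"
| scale: "X \<in> ideal_quot_module B J l \<Longrightarrow> quot_scale B l c X \<in> ideal_quot_module B J l"

definition annihilated ::
  "('f::field, 'b::ring, 'l::order, 'm) cell_data \<Rightarrow> 'b set \<Rightarrow> 'l set" where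
  "annihilated B J = {l \<in> cpos B. ideal_quot_module B J l = {cell_rad B l}}"

end

theory Submission
  imports Defs
begin

text \<open>
  The argument rests on one description of the Jacobson radical: it consists of the elements \<open>a\<close>
  with \<open>a W(\<lambda>) \<subseteq> R(\<lambda>)\<close> for all \<open>\<lambda>\<close>, that is, of the elements annihilating every \<open>L(\<lambda>)\<close>
  (\<open>jacobson_radical_eq_rad_ideal\<close>). If \<open>a\<close> annihilates every \<open>L(\<lambda>)\<close> and lies in a cell ideal
  \<open>B(I)\<close> with \<open>m\<close> maximal in \<open>I\<close>, then \<open>a\<^sup>3\<close> already lies in \<open>B(I - {m})\<close>, because
  \<open>C(s \<otimes> t) a C(u \<otimes> v)\<close> has leading coefficient \<open>\<phi>(t, a u) = 0\<close>; so \<open>a\<close> is nilpotent and \<open>1 - a\<close> is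
  invertible. If, on the other hand, \<open>\<phi>(a x, y) \<noteq> 0\<close>, then some multiple \<open>b a\<close> fixes the non-zero
  vector \<open>x\<close>, and \<open>1 - b a\<close> has no left inverse.

  Linear algebra on the Gram matrices gives, for each cell ideal \<open>B(I)\<close>, an element \<open>f \<in> B(I)\<close> acting
  as the identity on all \<open>L(\<lambda>)\<close> with \<open>\<lambda> \<in> I\<close> (\<open>ex_identity_on_quotients\<close>). With \<open>f\<close> for the indices
  below \<open>\<lambda>\<close> and \<open>z \<in> R(\<lambda>)\<close>, the element \<open>(1 - f) C(z \<otimes> x)\<close> annihilates every \<open>L(\<mu>)\<close> and differs from
  \<open>C(z \<otimes> x)\<close> by lower cells; the involution exchanges the two factors. This is the first claim.

  For the second claim, a radical element \<open>a\<close> of \<open>B(I)\<close> is written with such an \<open>f\<close> as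
  \<open>(a - f a) + (f a - f a f\<^sup>*) + f a f\<^sup>*\<close>. In the layer of a maximal \<open>m \<in> I\<close> the first two summands are
  sums of terms \<open>C(z \<otimes> x)\<close> and \<open>C(x \<otimes> z)\<close> with \<open>z \<in> R(m)\<close>, and the third vanishes, so that
  subtracting elements of \<open>X\<close> moves \<open>a\<close> into \<open>B(I - {m})\<close>, and induction applies.

  For the third claim, suppose first that \<open>J\<close> contains the radical. If \<open>\<phi>(u, v) = 1\<close>, a lift
  \<open>r \<in> J\<close> of \<open>C(z \<otimes> u)\<close> satisfies \<open>r v = z\<close>, whence \<open>R(\<lambda>) \<subseteq> J W(\<lambda>)\<close>. For the converse, the second
  claim reduces the inclusion to finding in \<open>J\<close> a radical element with each leading term
  \<open>C(z \<otimes> x)\<close>. As \<open>(1 - f) j\<close> is radical for every \<open>j\<close> with this leading term, it is enough that \<open>J\<close>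
  contains some such \<open>j\<close>: if \<open>J L(\<lambda>) \<noteq> 0\<close> it has the form \<open>C(z \<otimes> y) a C(w \<otimes> x)\<close> with
  \<open>\<phi>(y, a w) = 1\<close>, and otherwise \<open>z = \<Sum> a\<^sub>i w\<^sub>i\<close> with \<open>a\<^sub>i \<in> J\<close> and \<open>j = \<Sum> a\<^sub>i C(w\<^sub>i \<otimes> x)\<close>.
\<close>


section \<open>Quasi-regular elements and the Jacobson radical\<close>

context unital_algebra
begin

text \<open>
  The class \<open>ring\<close> has no constant for the unit, so one is chosen; it is the \<open>1\<close> of the comments
  below.
\<close>

definition unit_element :: 'b where
  "unit_element = (SOME e. \<forall>a. e * a = a \<and> a * e = a)"

lemma unit_left [simp]: "unit_element * a = a"
  and unit_right [simp]: "a * unit_element = a"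
proof -
  have "\<forall>a. unit_element * a = a \<and> a * unit_element = a"
    unfolding unit_element_def using unit_exists by (rule someI_ex)
  then show "unit_element * a = a" "a * unit_element = a" by auto
qed

lemma left_ideal_eq_UNIV:
  assumes "left_ideal sc I" "unit_element \<in> I"
  shows "I = UNIV"
proof -
  have "a * unit_element \<in> I" for a
    using assms unfolding left_ideal_def by blast
  then show ?thesis by auto
qed

lemma left_ideal_multiples: "left_ideal sc (range (\<lambda>c. c * a))"
proof -
  have "subspace (range (\<lambda>c. c * a))"
  proof (rule subspaceI)
    show "0 \<in> range (\<lambda>c. c * a)" by (auto intro: image_eqI[of _ _ 0])
    show "x + y \<in> range (\<lambda>c. c * a)"
      if "x \<in> range (\<lambda>c. c * a)" "y \<in> range (\<lambda>c. c * a)" for x y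
      using that by (auto simp: distrib_right[symmetric])
    show "sc k x \<in> range (\<lambda>c. c * a)" if "x \<in> range (\<lambda>c. c * a)" for k x
      using that by (auto simp: scale_mult_left[symmetric])
  qed
  then show ?thesis
    unfolding left_ideal_def by (auto simp: mult.assoc[symmetric])
qed

lemma left_ideal_sum:
  assumes "left_ideal sc I" "left_ideal sc K"
  shows "left_ideal sc {x + y | x y. x \<in> I \<and> y \<in> K}"
  using assms subspace_sums[of I K] unfolding left_ideal_def
  by (force simp: distrib_left)

lemma left_ideal_Union_chain:
  assumes chain: "subset.chain {K. left_ideal sc K} C" and "C \<noteq> {}"
  shows "left_ideal sc (\<Union>C)"
proof -
  have li: "left_ideal sc K" if "K \<in> C" for K
    using chain that by (auto simp: subset.chain_def)
  have "subspace (\<Union>C)"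
  proof (rule subspaceI)
    show "0 \<in> \<Union>C"
      using li \<open>C \<noteq> {}\<close> unfolding left_ideal_def by (auto dest: subspace_0)
  next
    fix x y assume "x \<in> \<Union>C" "y \<in> \<Union>C"
    then obtain K L where KL: "K \<in> C" "L \<in> C" "x \<in> K" "y \<in> L" by auto
    then have "K \<subseteq> L \<or> L \<subseteq> K"
      using chain unfolding subset.chain_def by blast
    then have "x + y \<in> K \<or> x + y \<in> L"
      using KL li unfolding left_ideal_def by (meson subsetD subspace_add)
    then show "x + y \<in> \<Union>C" using KL by blast
  next
    fix c x assume "x \<in> \<Union>C"
    then show "sc c x \<in> \<Union>C"
      using li unfolding left_ideal_def by (meson UnionE UnionI subspace_scale)
  qed
  then show ?thesis
    using li unfolding left_ideal_def by blast
qed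

text \<open>Zorn's lemma applies to the left ideals that omit the unit.\<close>

lemma ex_maximal_left_ideal:
  assumes "left_ideal sc I" "unit_element \<notin> I"
  shows "\<exists>M. maximal_left_ideal sc M \<and> I \<subseteq> M"
proof -
  let ?A = "{K. left_ideal sc K \<and> I \<subseteq> K \<and> unit_element \<notin> K}"
  have "\<exists>M\<in>?A. \<forall>X\<in>?A. M \<subseteq> X \<longrightarrow> X = M"
  proof (rule subset_Zorn_nonempty)
    show "?A \<noteq> {}" using assms by auto
  next
    fix C assume "C \<noteq> {}" and C: "subset.chain ?A C"
    then have "subset.chain {K. left_ideal sc K} C"
      unfolding subset.chain_def by blast
    then have "left_ideal sc (\<Union>C)"
      using left_ideal_Union_chain \<open>C \<noteq> {}\<close> by blast
    then show "\<Union>C \<in> ?A"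
      using \<open>C \<noteq> {}\<close> C unfolding subset.chain_def by blast
  qed
  then obtain M where M: "M \<in> ?A" and max: "\<forall>X\<in>?A. M \<subseteq> X \<longrightarrow> X = M"
    by (elim bexE)
  have "K = M \<or> K = UNIV" if K: "left_ideal sc K" "M \<subseteq> K" for K
  proof (cases "unit_element \<in> K")
    case False
    then have "K \<in> ?A" using M K by auto
    then show ?thesis using max K(2) by simp
  qed (simp add: left_ideal_eq_UNIV[OF K(1)])
  then have "maximal_left_ideal sc M"
    using M unfolding maximal_left_ideal_def by auto
  then show ?thesis using M by blast
qed

lemma left_ideal_jacobson_radical: "left_ideal sc (jacobson_radical sc)"
proof -
  have "subspace (jacobson_radical sc)"
    unfolding jacobson_radical_def
    by (rule subspace_Inter) (auto simp: maximal_left_ideal_def left_ideal_def)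
  then show ?thesis
    unfolding left_ideal_def jacobson_radical_def maximal_left_ideal_def by blast
qed

text \<open>
  If \<open>1 - a\<close> had no left inverse, a maximal left ideal would contain both \<open>1 - a\<close> and \<open>a\<close>.
\<close>

lemma jacobson_radical_left_inverse:
  assumes a: "a \<in> jacobson_radical sc"
  shows "\<exists>b. b * (unit_element - a) = unit_element"
proof (rule ccontr)
  assume "\<not> ?thesis"
  then have "unit_element \<notin> range (\<lambda>c. c * (unit_element - a))"
    by (auto simp only: image_iff dest: sym)
  then obtain M where M: "maximal_left_ideal sc M" "range (\<lambda>c. c * (unit_element - a)) \<subseteq> M"
    using ex_maximal_left_ideal left_ideal_multiples by meson
  have "unit_element * (unit_element - a) \<in> M" using M(2) by blast
  then have "unit_element - a \<in> M" by simp
  moreover have "a \<in> M" using a M(1) by (auto simp: jacobson_radical_def)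
  moreover have "subspace M" using M(1) by (auto simp: maximal_left_ideal_def left_ideal_def)
  ultimately have "(unit_element - a) + a \<in> M" by (blast intro: subspace_add)
  then show False
    using M(1) left_ideal_eq_UNIV by (auto simp: maximal_left_ideal_def)
qed

text \<open>
  A maximal left ideal \<open>M\<close> that misses some \<open>a \<in> N\<close> satisfies \<open>M + Ba = B\<close>, so \<open>1 = m + ca\<close>;
  the left inverse of \<open>1 - ca = m\<close> then puts the unit in \<open>M\<close>.
\<close>

lemma quasi_regular_left_ideal_subset_jacobson_radical:
  assumes N: "left_ideal sc N"
    and inverse: "\<And>a. a \<in> N \<Longrightarrow> \<exists>b. b * (unit_element - a) = unit_element"
  shows "N \<subseteq> jacobson_radical sc"
proof
  fix a assume "a \<in> N"
  have "a \<in> M" if M: "maximal_left_ideal sc M" for M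
  proof (rule ccontr)
    assume "a \<notin> M"
    let ?K = "{x + y | x y. x \<in> M \<and> y \<in> range (\<lambda>c. c * a)}"
    have lM: "left_ideal sc M" using M by (simp add: maximal_left_ideal_def)
    then have "left_ideal sc ?K" by (rule left_ideal_sum[OF _ left_ideal_multiples])
    moreover have "x \<in> ?K" if "x \<in> M" for x
    proof -
      have "x = x + 0 * a" by simp
      then show ?thesis using that by blast
    qed
    then have "M \<subseteq> ?K" by (rule subsetI)
    moreover have "a = 0 + unit_element * a" by simp
    then have "a \<in> ?K" using lM unfolding left_ideal_def using subspace_0 by blast
    ultimately have "?K = UNIV"
      using M \<open>a \<notin> M\<close> unfolding maximal_left_ideal_def by blast
    then have "unit_element \<in> ?K" by simp
    then obtain m c where m: "m \<in> M" "unit_element = m + c * a" by auto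
    have "c * a \<in> N" using N \<open>a \<in> N\<close> unfolding left_ideal_def by blast
    then obtain b where "b * (unit_element - c * a) = unit_element" using inverse by blast
    moreover have "unit_element - c * a = m" by (simp only: m(2) add_diff_cancel_right')
    ultimately have "unit_element \<in> M" using lM m(1) unfolding left_ideal_def by metis
    then show False
      using M lM left_ideal_eq_UNIV by (auto simp: maximal_left_ideal_def)
  qed
  then show "a \<in> jacobson_radical sc" by (auto simp: jacobson_radical_def)
qed

end

section \<open>Coordinate vectors\<close>

lemma vector_space_fscale: "vector_space (fscale :: 'f::field \<Rightarrow> ('m \<Rightarrow> 'f) \<Rightarrow> 'm \<Rightarrow> 'f)"
  by unfold_locales (auto simp: fscale_def algebra_simps fun_eq_iff)

interpretation fun_space: vector_space "fscale :: 'f::field \<Rightarrow> ('m \<Rightarrow> 'f) \<Rightarrow> 'm \<Rightarrow> 'f"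
  by (rule vector_space_fscale)

lemma fscale_apply [simp]: "fscale c x S = c * x S"
  by (simp add: fscale_def)

lemma sum_fun_apply: "(\<Sum>i\<in>A. f i) S = (\<Sum>i\<in>A. f i S)" for f :: "'i \<Rightarrow> 'm \<Rightarrow> 'f::field"
  by (induction A rule: infinite_finite_induct) auto

definition indic :: "'m \<Rightarrow> 'm \<Rightarrow> 'f::field" where
  "indic T = (\<lambda>S. if S = T then 1 else 0)"

context cellular_algebra
begin

lemma indic_in_cell_module: "T \<in> tab B l \<Longrightarrow> indic T \<in> cell_module B l"
  by (auto simp: indic_def cell_module_def)

lemma cell_module_subspace: "fun_space.subspace (cell_module B l)"
  by (rule fun_space.subspaceI) (auto simp: cell_module_def)

lemma cell_module_expansion:
  assumes "l \<in> cpos B" "x \<in> cell_module B l"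
  shows "x = (\<Sum>T\<in>tab B l. fscale (x T) (indic T))"
proof
  fix S
  have "(\<Sum>T\<in>tab B l. fscale (x T) (indic T)) S = (\<Sum>T\<in>tab B l. if T = S then x T else 0)"
    by (auto simp: sum_fun_apply indic_def intro!: sum.cong)
  then show "x S = (\<Sum>T\<in>tab B l. fscale (x T) (indic T)) S"
    using assms finite_tab[OF assms(1)] by (auto simp: cell_module_def)
qed

section \<open>Coordinates with respect to the cellular basis\<close>

definition cell_basis :: "'b set" where
  "cell_basis = (\<lambda>(l, S, T). cbas B l S T) ` cell_index B"

definition coord :: "'b \<Rightarrow> 'l \<Rightarrow> 'm \<Rightarrow> 'm \<Rightarrow> 'f" where
  "coord a l S T = representation cell_basis a (cbas B l S T)"

lemma cell_basis_independent: "independent cell_basis"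
  and cell_basis_span: "a \<in> span cell_basis"
  using basis_independent basis_span unfolding cell_basis_def by auto

lemma coord_add [simp]: "coord (a + b) l S T = coord a l S T + coord b l S T"
  by (simp add: coord_def representation_add cell_basis_independent cell_basis_span)

lemma coord_diff [simp]: "coord (a - b) l S T = coord a l S T - coord b l S T"
  by (simp add: coord_def representation_diff cell_basis_independent cell_basis_span)

lemma coord_zero [simp]: "coord 0 l S T = 0"
  by (simp add: coord_def representation_zero)

lemma coord_scale [simp]: "coord (smul B c a) l S T = c * coord a l S T"
  by (simp add: coord_def representation_scale cell_basis_independent cell_basis_span)

lemma coord_sum: "coord (\<Sum>i\<in>A. f i) l S T = (\<Sum>i\<in>A. coord (f i) l S T)"
  by (induction A rule: infinite_finite_induct) auto

lemma coord_cbas: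
  assumes "(m, U, V) \<in> cell_index B" "(l, S, T) \<in> cell_index B"
  shows "coord (cbas B m U V) l S T = (if l = m \<and> S = U \<and> T = V then 1 else 0)"
proof -
  have "cbas B m U V \<in> cell_basis" using assms by (force simp: cell_basis_def)
  moreover have "cbas B l S T = cbas B m U V \<longleftrightarrow> l = m \<and> S = U \<and> T = V"
    using inj_onD[OF basis_inj, of "(l, S, T)" "(m, U, V)"] assms by auto
  ultimately show ?thesis
    by (simp add: coord_def representation_basis cell_basis_independent)
qed

text \<open>
  For \<open>I\<close> closed downwards this is the cell ideal \<open>B(I)\<close>; the ideals \<open>B(<\<lambda>)\<close> and \<open>B(\<le>\<lambda>)\<close> and \<open>B\<close>
  itself are of this kind.
\<close>

definition cell_span :: "'l set \<Rightarrow> 'b set" where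
  "cell_span I = span {cbas B m U V | m U V. (m, U, V) \<in> cell_index B \<and> m \<in> I}"

lemma cell_span_subspace: "subspace (cell_span I)"
  by (simp add: cell_span_def)

text \<open>
  Congruences modulo lower cells become statements about coordinates.
\<close>

lemma mem_cell_span_iff:
  "a \<in> cell_span I \<longleftrightarrow>
     (\<forall>l S T. (l, S, T) \<in> cell_index B \<longrightarrow> l \<notin> I \<longrightarrow> coord a l S T = 0)"
proof
  have "subspace {a. \<forall>l S T. (l, S, T) \<in> cell_index B \<longrightarrow> l \<notin> I \<longrightarrow> coord a l S T = 0}"
    by (rule subspaceI) auto
  then have "cell_span I \<subseteq>
      {a. \<forall>l S T. (l, S, T) \<in> cell_index B \<longrightarrow> l \<notin> I \<longrightarrow> coord a l S T = 0}"
    unfolding cell_span_def by (intro span_minimal) (auto simp: coord_cbas)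
  then show "a \<in> cell_span I \<Longrightarrow>
      \<forall>l S T. (l, S, T) \<in> cell_index B \<longrightarrow> l \<notin> I \<longrightarrow> coord a l S T = 0" by blast
next
  assume *: "\<forall>l S T. (l, S, T) \<in> cell_index B \<longrightarrow> l \<notin> I \<longrightarrow> coord a l S T = 0"
  let ?r = "representation cell_basis a"
  have "smul B (?r b) b \<in> cell_span I" if b: "b \<in> {b. ?r b \<noteq> 0}" for b
  proof -
    have "b \<in> cell_basis" using b representation_ne_zero by auto
    then obtain l S T where lST: "(l, S, T) \<in> cell_index B" "b = cbas B l S T"
      by (auto simp: cell_basis_def)
    then have "l \<in> I" using * b by (auto simp: coord_def)
    then show ?thesis
      unfolding cell_span_def using lST by (intro span_scale span_base) blast
  qed
  then have "(\<Sum>b | ?r b \<noteq> 0. smul B (?r b) b) \<in> cell_span I"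
    unfolding cell_span_def by (intro span_sum)
  then show "a \<in> cell_span I"
    using sum_nonzero_representation_eq[OF cell_basis_independent cell_basis_span] by simp
qed

lemma cell_span_mono: "I \<subseteq> K \<Longrightarrow> cell_span I \<subseteq> cell_span K"
  unfolding cell_span_def by (rule span_mono) blast

lemma cell_span_empty: "a \<in> cell_span {} \<Longrightarrow> a = 0"
  by (simp add: cell_span_def)

lemma cell_span_cpos: "a \<in> cell_span (cpos B)"
  by (auto simp: mem_cell_span_iff cell_index_def)

lemma B_less_eq_cell_span: "B_less B l = cell_span {m \<in> cpos B. m < l}"
  unfolding B_less_def cell_span_def by (rule arg_cong[where f = span]) (auto simp: cell_index_def)

text \<open>
  Written \<open>C(x \<otimes> y)\<close> in the comments below.
\<close>

abbreviation pure :: "'l \<Rightarrow> ('m \<Rightarrow> 'f) \<Rightarrow> ('m \<Rightarrow> 'f) \<Rightarrow> 'b" where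
  "pure l x y \<equiv> cell_map B l (x \<otimes> y)"

lemma coord_cell_map:
  assumes "l \<in> cpos B" "(m, S, T) \<in> cell_index B"
  shows "coord (cell_map B l t) m S T = (if m = l then t (S, T) else 0)"
proof -
  have "coord (cell_map B l t) m S T =
      (\<Sum>p\<in>tab B l \<times> tab B l. if p = (S, T) \<and> m = l then t p else 0)"
    unfolding cell_map_def using assms
    by (auto simp: coord_sum split_beta intro!: sum.cong)
       (auto simp: coord_cbas cell_index_def)
  also have "\<dots> = (if m = l then t (S, T) else 0)"
    using assms finite_tab[OF assms(1)] by (auto simp: cell_index_def)
  finally show ?thesis .
qed

lemma coord_eqI:
  assumes "\<And>l S T. (l, S, T) \<in> cell_index B \<Longrightarrow> coord a l S T = coord b l S T"
  shows "a = b"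
proof -
  have "a - b \<in> cell_span {}" using assms by (simp add: mem_cell_span_iff)
  then show ?thesis using cell_span_empty by fastforce
qed

lemma pure_add_left: "l \<in> cpos B \<Longrightarrow> pure l (x + y) z = pure l x z + pure l y z"
  and pure_diff_left: "l \<in> cpos B \<Longrightarrow> pure l (x - y) z = pure l x z - pure l y z"
  and pure_scale_left: "l \<in> cpos B \<Longrightarrow> pure l (fscale c x) z = smul B c (pure l x z)"
  and pure_zero_left: "l \<in> cpos B \<Longrightarrow> pure l 0 z = 0"
  by (rule coord_eqI; simp add: coord_cell_map tensor_def algebra_simps)+

text \<open>
  Both sides are linear in \<open>a\<close> and agree on the cellular basis.
\<close>

lemma coord_invol:
  assumes "(l, S, T) \<in> cell_index B"
  shows "coord (invol B a) l S T = coord a l T S"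
proof -
  interpret inv: Vector_Spaces.linear "smul B" "smul B" "invol B" by (rule invol_linear)
  have "subspace {a. \<forall>l S T. (l, S, T) \<in> cell_index B \<longrightarrow> coord (invol B a) l S T = coord a l T S}"
    by (rule subspaceI) (auto simp: inv.add inv.scale)
  then have "span cell_basis \<subseteq>
      {a. \<forall>l S T. (l, S, T) \<in> cell_index B \<longrightarrow> coord (invol B a) l S T = coord a l T S}"
    by (intro span_minimal)
       (auto simp: cell_basis_def invol_basis coord_cbas cell_index_def)
  then show ?thesis using cell_basis_span assms by blast
qed

lemma invol_diff: "invol B (a - b) = invol B a - invol B b"
proof -
  interpret inv: Vector_Spaces.linear "smul B" "smul B" "invol B" by (rule invol_linear)
  show ?thesis by (rule inv.diff)
qed

lemma invol_sum: "invol B (\<Sum>i\<in>A. f i) = (\<Sum>i\<in>A. invol B (f i))"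
proof -
  interpret inv: Vector_Spaces.linear "smul B" "smul B" "invol B" by (rule invol_linear)
  show ?thesis by (rule inv.sum)
qed

lemma invol_pure: "l \<in> cpos B \<Longrightarrow> invol B (pure l x y) = pure l y x"
  by (rule coord_eqI) (auto simp: coord_invol coord_cell_map cell_index_def tensor_def)

lemma invol_in_cell_span: "a \<in> cell_span I \<Longrightarrow> invol B a \<in> cell_span I"
  by (auto simp: mem_cell_span_iff coord_invol cell_index_def)

section \<open>Cell ideals and the action on cell modules\<close>

definition down_set :: "'l set \<Rightarrow> bool" where
  "down_set I \<longleftrightarrow> I \<subseteq> cpos B \<and> (\<forall>m\<in>I. \<forall>k\<in>cpos B. k < m \<longrightarrow> k \<in> I)"

lemma down_set_less: "down_set {m \<in> cpos B. m < l}"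
  by (auto simp: down_set_def)

text \<open>
  Cell ideals are dismantled one maximal cell at a time.
\<close>

lemma down_set_induct [consumes 1, case_names empty step]:
  assumes "down_set I" and "P {}"
    and "\<And>I m. down_set I \<Longrightarrow> m \<in> I \<Longrightarrow> down_set (I - {m}) \<Longrightarrow> P (I - {m}) \<Longrightarrow> P I"
  shows "P I"
proof -
  have "finite I"
    using assms(1) finite_poset by (auto simp: down_set_def intro: finite_subset)
  then show ?thesis using assms(1)
  proof (induction I rule: finite_psubset_induct)
    case (psubset I)
    show ?case
    proof (cases "I = {}")
      case False
      then obtain m where m: "m \<in> I" "\<forall>k\<in>I. m \<le> k \<longrightarrow> m = k"
        using finite_has_maximal[OF psubset.hyps(1)] by blast
      then have "down_set (I - {m})"
        using psubset.prems unfolding down_set_def by fastforce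
      then show ?thesis using m psubset assms(3) by blast
    qed (simp add: assms(2))
  qed
qed

lemma B_less_subset:
  "down_set I \<Longrightarrow> m \<in> I \<Longrightarrow> B_less B m \<subseteq> cell_span (I - {m})"
  unfolding B_less_eq_cell_span by (rule cell_span_mono) (auto simp: down_set_def)

lemma mult_cbas:
  assumes "l \<in> cpos B" "S \<in> tab B l" "T \<in> tab B l"
  shows "a * cbas B l S T - (\<Sum>S'\<in>tab B l. smul B (act_coeff B l a S' S) (cbas B l S' T))
      \<in> B_less B l"
proof -
  have "cell_coeffs B l a (act_coeff B l a)"
    unfolding act_coeff_def by (rule someI_ex[OF cell_action[OF assms(1)]])
  then show ?thesis using assms by (auto simp: cell_coeffs_def)
qed

lemma cell_span_mult_left:
  assumes I: "down_set I" and "x \<in> cell_span I"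
  shows "a * x \<in> cell_span I"
proof -
  have "subspace {x. a * x \<in> cell_span I}"
    using cell_span_subspace[of I] unfolding subspace_def
    by (auto simp: distrib_left scale_mult_right)
  moreover have "a * cbas B m U V \<in> cell_span I" if m: "(m, U, V) \<in> cell_index B" "m \<in> I" for m U V
  proof -
    let ?s = "\<Sum>S'\<in>tab B m. smul B (act_coeff B m a S' U) (cbas B m S' V)"
    have "?s \<in> cell_span I"
      unfolding cell_span_def using m
      by (intro span_sum span_scale span_base) (auto simp: cell_index_def)
    moreover have "a * cbas B m U V - ?s \<in> cell_span I"
      using mult_cbas[of m U V a] m B_less_subset[OF I m(2)] cell_span_mono[of "I - {m}" I]
      by (auto simp: cell_index_def)
    ultimately have "(a * cbas B m U V - ?s) + ?s \<in> cell_span I"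
      by (meson cell_span_subspace subspace_add)
    then show ?thesis by simp
  qed
  then have "{cbas B m U V | m U V. (m, U, V) \<in> cell_index B \<and> m \<in> I} \<subseteq> {x. a * x \<in> cell_span I}"
    by blast
  ultimately have "cell_span I \<subseteq> {x. a * x \<in> cell_span I}"
    by (subst (1) cell_span_def) (rule span_minimal)
  then show ?thesis using assms(2) by blast
qed

text \<open>
  The involution preserves each cell ideal and so turns left ideals into right ideals.
\<close>

lemma cell_span_mult_right:
  assumes "down_set I" "x \<in> cell_span I"
  shows "x * a \<in> cell_span I"
proof -
  have "invol B (invol B a * invol B x) \<in> cell_span I"
    using assms by (intro invol_in_cell_span cell_span_mult_left)
  then show ?thesis by (simp add: invol_mult invol_invol)
qed

lemma cell_act_in_cell_module: "cell_act B l a x \<in> cell_module B l"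
  by (auto simp: cell_act_def cell_module_def)

text \<open>
  Multiplication by \<open>a\<close> on the left factor of \<open>C(x \<otimes> y)\<close> is the cell action; the involution
  carries this to the right factor.
\<close>

lemma mult_pure:
  assumes l: "l \<in> cpos B"
  shows "a * pure l x y - pure l (cell_act B l a x) y \<in> B_less B l"
proof -
  let ?M = "tab B l"
  let ?r = "act_coeff B l a"
  have pure_eq: "pure l v y = (\<Sum>S\<in>?M. \<Sum>T\<in>?M. smul B (v S * y T) (cbas B l S T))" for v
    by (simp add: cell_map_def tensor_def sum.cartesian_product split_beta)
  have "a * pure l x y - pure l (cell_act B l a x) y =
    (\<Sum>S\<in>?M. \<Sum>T\<in>?M. smul B (x S * y T)
      (a * cbas B l S T - (\<Sum>S'\<in>?M. smul B (?r S' S) (cbas B l S' T))))"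
  proof -
    have "pure l (cell_act B l a x) y =
        (\<Sum>S'\<in>?M. \<Sum>T\<in>?M. \<Sum>S\<in>?M. smul B (?r S' S * x S * y T) (cbas B l S' T))"
      by (simp add: pure_eq cell_act_def sum_distrib_right scale_sum_left)
    also have "\<dots> = (\<Sum>T\<in>?M. \<Sum>S\<in>?M. \<Sum>S'\<in>?M. smul B (?r S' S * x S * y T) (cbas B l S' T))"
      by (subst sum.swap) (rule sum.cong[OF refl], rule sum.swap)
    also have "\<dots> = (\<Sum>S\<in>?M. \<Sum>T\<in>?M. \<Sum>S'\<in>?M. smul B (?r S' S * x S * y T) (cbas B l S' T))"
      by (rule sum.swap)
    finally have "pure l (cell_act B l a x) y = \<dots>" .
    moreover have "a * pure l x y = (\<Sum>S\<in>?M. \<Sum>T\<in>?M. smul B (x S * y T) (a * cbas B l S T))"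
      unfolding pure_eq sum_distrib_left scale_mult_right ..
    moreover have "smul B (x S * y T) (\<Sum>S'\<in>?M. smul B (?r S' S) (cbas B l S' T)) =
        (\<Sum>S'\<in>?M. smul B (?r S' S * x S * y T) (cbas B l S' T))" for S T
      unfolding scale_sum_right scale_scale by (simp only: ac_simps)
    ultimately show ?thesis
      by (simp only: scale_right_diff_distrib sum_subtractf)
  qed
  also have "\<dots> \<in> B_less B l"
    unfolding B_less_eq_cell_span
    by (intro subspace_sum[OF cell_span_subspace] subspace_scale[OF cell_span_subspace])
       (use mult_cbas[OF l] in \<open>simp add: B_less_eq_cell_span\<close>)
  finally show ?thesis .
qed

lemma pure_mult:
  assumes l: "l \<in> cpos B"
  shows "pure l x y * a - pure l x (cell_act B l (invol B a) y) \<in> B_less B l"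
proof -
  have "invol B (invol B a * pure l y x - pure l (cell_act B l (invol B a) y) x) \<in> B_less B l"
    using mult_pure[OF l] invol_in_cell_span by (simp add: B_less_eq_cell_span)
  then show ?thesis by (simp add: invol_diff invol_mult invol_invol invol_pure l)
qed

lemma B_less_subspace: "subspace (B_less B l)"
  by (simp add: B_less_eq_cell_span cell_span_subspace)

lemma B_less_mult_left: "x \<in> B_less B l \<Longrightarrow> a * x \<in> B_less B l"
  and B_less_mult_right: "x \<in> B_less B l \<Longrightarrow> x * a \<in> B_less B l"
  unfolding B_less_eq_cell_span
  using down_set_less cell_span_mult_left cell_span_mult_right by auto

lemma coord_cong:
  assumes "a - b \<in> B_less B l" "(l, S, T) \<in> cell_index B"
  shows "coord a l S T = coord b l S T"
  using assms unfolding B_less_eq_cell_span mem_cell_span_iff by force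

text \<open>
  A cell-module vector can be read off from the coordinates of pure elements, so module
  identities may be checked inside the algebra, modulo lower cells.
\<close>

lemma pure_eqI:
  assumes "l \<in> cpos B" "w \<in> cell_module B l" "w' \<in> cell_module B l" "l \<notin> I"
    and "\<And>T. T \<in> tab B l \<Longrightarrow> pure l w (indic T) - pure l w' (indic T) \<in> cell_span I"
  shows "w = w'"
proof
  fix S show "w S = w' S"
  proof (cases "S \<in> tab B l")
    case True
    then have idx: "(l, S, S) \<in> cell_index B" using assms(1) by (simp add: cell_index_def)
    then have "coord (pure l w (indic S) - pure l w' (indic S)) l S S = 0"
      using assms(4) assms(5)[OF True] by (auto simp: mem_cell_span_iff)
    then show ?thesis
      using idx assms(1) by (simp add: coord_cell_map tensor_def indic_def)
  qed (use assms(2,3) in \<open>auto simp: cell_module_def\<close>)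
qed

lemma cell_act_eqI:
  assumes "l \<in> cpos B" "w \<in> cell_module B l"
    and "\<And>T. T \<in> tab B l \<Longrightarrow> a * pure l x (indic T) - pure l w (indic T) \<in> B_less B l"
  shows "cell_act B l a x = w"
proof (rule pure_eqI[where I = "{m \<in> cpos B. m < l}"])
  fix T assume "T \<in> tab B l"
  then have "(a * pure l x (indic T) - pure l w (indic T)) -
      (a * pure l x (indic T) - pure l (cell_act B l a x) (indic T)) \<in> B_less B l"
    by (rule subspace_diff[OF B_less_subspace assms(3) mult_pure[OF assms(1)]])
  then show "pure l (cell_act B l a x) (indic T) - pure l w (indic T)
      \<in> cell_span {m \<in> cpos B. m < l}"
    by (simp add: B_less_eq_cell_span)
qed (use assms in \<open>auto simp: cell_act_in_cell_module\<close>)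

lemma cell_act_zero_vec: "cell_act B l a 0 = 0"
  by (auto simp: fun_eq_iff cell_act_def)

lemma cell_act_add:
  assumes l: "l \<in> cpos B"
  shows "cell_act B l (a + b) x = cell_act B l a x + cell_act B l b x"
proof (rule cell_act_eqI[OF l])
  fix T assume "T \<in> tab B l"
  have "(a * pure l x (indic T) - pure l (cell_act B l a x) (indic T)) +
      (b * pure l x (indic T) - pure l (cell_act B l b x) (indic T)) \<in> B_less B l"
    by (rule subspace_add[OF B_less_subspace mult_pure[OF l] mult_pure[OF l]])
  then show "(a + b) * pure l x (indic T) -
      pure l (cell_act B l a x + cell_act B l b x) (indic T) \<in> B_less B l"
    by (simp add: pure_add_left l algebra_simps)
qed (intro fun_space.subspace_add[OF cell_module_subspace] cell_act_in_cell_module)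

lemma cell_act_scale:
  assumes l: "l \<in> cpos B"
  shows "cell_act B l (smul B c a) x = fscale c (cell_act B l a x)"
proof (rule cell_act_eqI[OF l])
  fix T assume "T \<in> tab B l"
  have "smul B c (a * pure l x (indic T) - pure l (cell_act B l a x) (indic T)) \<in> B_less B l"
    by (rule subspace_scale[OF B_less_subspace mult_pure[OF l]])
  then show "smul B c a * pure l x (indic T) -
      pure l (fscale c (cell_act B l a x)) (indic T) \<in> B_less B l"
    by (simp add: pure_scale_left l scale_mult_left scale_right_diff_distrib)
qed (intro fun_space.subspace_scale[OF cell_module_subspace] cell_act_in_cell_module)

lemma cell_act_diff:
  assumes l: "l \<in> cpos B"
  shows "cell_act B l (a - b) x = cell_act B l a x - cell_act B l b x"
proof -
  have "cell_act B l ((a - b) + b) x = cell_act B l (a - b) x + cell_act B l b x"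
    by (rule cell_act_add[OF l])
  then show ?thesis by simp
qed

lemma cell_act_sum:
  assumes l: "l \<in> cpos B"
  shows "cell_act B l (\<Sum>i\<in>A. f i) x = (\<Sum>i\<in>A. cell_act B l (f i) x)"
proof -
  have "cell_act B l 0 x = 0" using cell_act_diff[OF l, of 0 0 x] by simp
  then show ?thesis
    by (induction A rule: infinite_finite_induct) (auto simp: cell_act_add[OF l])
qed

lemma cell_act_mult:
  assumes l: "l \<in> cpos B"
  shows "cell_act B l (a * b) x = cell_act B l a (cell_act B l b x)"
proof (rule cell_act_eqI[OF l])
  fix T assume "T \<in> tab B l"
  have "a * (b * pure l x (indic T) - pure l (cell_act B l b x) (indic T)) +
      (a * pure l (cell_act B l b x) (indic T) -
        pure l (cell_act B l a (cell_act B l b x)) (indic T)) \<in> B_less B l"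
    by (rule subspace_add[OF B_less_subspace B_less_mult_left[OF mult_pure[OF l]] mult_pure[OF l]])
  then show "a * b * pure l x (indic T) -
      pure l (cell_act B l a (cell_act B l b x)) (indic T) \<in> B_less B l"
    by (simp add: algebra_simps)
qed (rule cell_act_in_cell_module)

lemma cell_act_unit:
  "l \<in> cpos B \<Longrightarrow> x \<in> cell_module B l \<Longrightarrow> cell_act B l unit_element x = x"
  by (rule cell_act_eqI) (auto simp: subspace_0[OF B_less_subspace])

text \<open>
  The product \<open>b C(x \<otimes> y)\<close> stays in the ideal \<open>B(K)\<close>, which has no part in the cell \<open>l\<close>, whereas
  its layer there is \<open>C(b x \<otimes> y)\<close>.
\<close>

lemma cell_act_eq_zero:
  assumes K: "down_set K" and b: "b \<in> cell_span K" and l: "l \<in> cpos B" "l \<notin> K"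
  shows "cell_act B l b x = 0"
proof (rule pure_eqI[where I = "K \<union> {m \<in> cpos B. m < l}"])
  fix T assume "T \<in> tab B l"
  let ?I = "K \<union> {m \<in> cpos B. m < l}"
  have "b * pure l x (indic T) \<in> cell_span ?I"
    using cell_span_mult_right[OF K b] cell_span_mono[of K ?I] by blast
  moreover have "b * pure l x (indic T) - pure l (cell_act B l b x) (indic T) \<in> cell_span ?I"
    using mult_pure[OF l(1)] cell_span_mono[of _ ?I] unfolding B_less_eq_cell_span by blast
  ultimately have "b * pure l x (indic T) -
      (b * pure l x (indic T) - pure l (cell_act B l b x) (indic T)) \<in> cell_span ?I"
    by (rule subspace_diff[OF cell_span_subspace])
  then show "pure l (cell_act B l b x) (indic T) - pure l 0 (indic T) \<in> cell_span ?I"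
    by (simp add: pure_zero_left l)
qed (use l in \<open>auto simp: cell_act_in_cell_module fun_space.subspace_0[OF cell_module_subspace]\<close>)

section \<open>The invariant form\<close>

lemma coord_mult_cbas:
  assumes l: "l \<in> cpos B" and "U \<in> tab B l" "V \<in> tab B l" "S \<in> tab B l" "W \<in> tab B l"
  shows "coord (a * cbas B l U V) l S W = (if W = V then act_coeff B l a S U else 0)"
proof -
  let ?s = "\<Sum>S'\<in>tab B l. smul B (act_coeff B l a S' U) (cbas B l S' V)"
  have "coord (a * cbas B l U V) l S W = coord ?s l S W"
    using mult_cbas[of l U V a] assms by (intro coord_cong) (auto simp: cell_index_def)
  also have "\<dots> = (\<Sum>S'\<in>tab B l. if S' = S then (if W = V then act_coeff B l a S U else 0) else 0)"
    using assms by (auto simp: coord_sum coord_cbas cell_index_def intro!: sum.cong)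
  also have "\<dots> = (if W = V then act_coeff B l a S U else 0)"
    using assms finite_tab[OF l] by simp
  finally show ?thesis .
qed

text \<open>
  The product \<open>C\<^sub>S\<^sub>T C\<^sub>U\<^sub>V\<close> has, modulo lower cells, second index \<open>V\<close> with coefficients independent
  of \<open>V\<close>; through the involution it has first index \<open>S\<close> with coefficients independent of \<open>S\<close>.
  Hence it is a multiple of \<open>C\<^sub>S\<^sub>V\<close> by a scalar depending on \<open>T\<close> and \<open>U\<close> only.
\<close>

lemma gram_cbas:
  assumes l: "l \<in> cpos B" and T: "T \<in> tab B l" and U: "U \<in> tab B l"
    and SV: "S \<in> tab B l" "V \<in> tab B l"
  shows "cbas B l S T * cbas B l U V - smul B (gram B l T U) (cbas B l S V) \<in> B_less B l"
proof -
  define P where "P S V = cbas B l S T * cbas B l U V" for S V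
  have idx: "(l, S, V) \<in> cell_index B" if "S \<in> tab B l" "V \<in> tab B l" for S V
    using that l by (simp add: cell_index_def)
  have right: "coord (P S V) l S' V' = (if V' = V then act_coeff B l (cbas B l S T) S' U else 0)"
    if "S \<in> tab B l" "V \<in> tab B l" "S' \<in> tab B l" "V' \<in> tab B l" for S V S' V'
    unfolding P_def using that l T U by (intro coord_mult_cbas)
  have left: "coord (P S V) l S' V' = (if S' = S then act_coeff B l (cbas B l V U) V' T else 0)"
    if "S \<in> tab B l" "V \<in> tab B l" "S' \<in> tab B l" "V' \<in> tab B l" for S V S' V'
  proof -
    have "coord (P S V) l S' V' = coord (invol B (P S V)) l V' S'"
      using that idx by (simp add: coord_invol)
    also have "invol B (P S V) = cbas B l V U * cbas B l T S"
      using that T U idx by (simp add: P_def invol_mult invol_basis)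
    finally show ?thesis using that l T U by (simp add: coord_mult_cbas)
  qed
  define c where "c = coord (P T U) l T U"
  have diag: "coord (P S V) l S V = c" if "S \<in> tab B l" "V \<in> tab B l" for S V
  proof -
    have "coord (P S V) l S V = coord (P S U) l S U" using right that U by simp
    also have "\<dots> = c" using left that T U by (simp add: c_def)
    finally show ?thesis .
  qed
  have "P S V - smul B c (cbas B l S V) \<in> B_less B l" if SV: "S \<in> tab B l" "V \<in> tab B l" for S V
  proof -
    have down: "down_set {m \<in> cpos B. m \<le> l}" by (auto simp: down_set_def)
    have "cbas B l S V \<in> cell_span {m \<in> cpos B. m \<le> l}" if "S \<in> tab B l" "V \<in> tab B l" for S V
      unfolding cell_span_def using that idx l by (intro span_base) blast
    then have mem: "P S V - smul B c (cbas B l S V) \<in> cell_span {m \<in> cpos B. m \<le> l}"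
      unfolding P_def using SV U
      by (intro subspace_diff[OF cell_span_subspace] subspace_scale[OF cell_span_subspace]
          cell_span_mult_left[OF down]) auto
    have "coord (P S V - smul B c (cbas B l S V)) l S' V' = 0"
      if "S' \<in> tab B l" "V' \<in> tab B l" for S' V'
    proof (cases "S' = S \<and> V' = V")
      case True then show ?thesis using SV idx by (simp add: diag coord_cbas)
    next
      case False
      then have "coord (P S V) l S' V' = 0"
        using right[OF SV that] left[OF SV that] by auto
      then show ?thesis using False SV that idx by (auto simp: coord_cbas)
    qed
    moreover have "coord (P S V - smul B c (cbas B l S V)) k S' V' = 0"
      if "(k, S', V') \<in> cell_index B" "\<not> k \<le> l" for k S' V'
      using mem that unfolding mem_cell_span_iff by blast
    ultimately show ?thesis
      unfolding B_less_eq_cell_span mem_cell_span_iff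
      by (metis (mono_tags, lifting) cell_index_def case_prodD le_less mem_Collect_eq)
  qed
  then have "\<exists>c. \<forall>S\<in>tab B l. \<forall>V\<in>tab B l.
      cbas B l S T * cbas B l U V - smul B c (cbas B l S V) \<in> B_less B l"
    unfolding P_def by blast
  from someI_ex[OF this, folded gram_def] show ?thesis using SV by blast
qed

text \<open>
  The relation defining the Gram matrix, extended from the basis by multilinearity.
\<close>

lemma pure_mult_pure:
  assumes l: "l \<in> cpos B"
  shows "pure l s t * pure l u v - smul B (cell_form B l t u) (pure l s v) \<in> B_less B l"
proof -
  let ?M = "tab B l"
  have pure_eq: "pure l x y = (\<Sum>S\<in>?M. \<Sum>T\<in>?M. smul B (x S * y T) (cbas B l S T))" for x y
    by (simp add: cell_map_def tensor_def sum.cartesian_product split_beta)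
  let ?k = "\<lambda>S T U V. s S * t T * u U * v V"
  have "pure l s t * pure l u v =
      (\<Sum>S\<in>?M. \<Sum>T\<in>?M. \<Sum>U\<in>?M. \<Sum>V\<in>?M. smul B (?k S T U V) (cbas B l S T * cbas B l U V))"
    unfolding pure_eq
    by (simp only: sum_distrib_right)
       (simp only: sum_distrib_left scale_mult_left scale_mult_right scale_scale ac_simps)
  moreover have "smul B (cell_form B l t u) (pure l s v) =
      (\<Sum>S\<in>?M. \<Sum>T\<in>?M. \<Sum>U\<in>?M. \<Sum>V\<in>?M. smul B (?k S T U V) (smul B (gram B l T U) (cbas B l S V)))"
  proof -
    have "smul B (cell_form B l t u) (pure l s v) =
        (\<Sum>T\<in>?M. \<Sum>U\<in>?M. \<Sum>S\<in>?M. \<Sum>V\<in>?M.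
          smul B (t T * u U * gram B l T U * (s S * v V)) (cbas B l S V))"
      unfolding cell_form_def pure_eq by (simp only: scale_sum_left)
         (simp only: scale_sum_right scale_scale)
    also have "\<dots> = (\<Sum>T\<in>?M. \<Sum>S\<in>?M. \<Sum>U\<in>?M. \<Sum>V\<in>?M.
          smul B (t T * u U * gram B l T U * (s S * v V)) (cbas B l S V))"
      by (intro sum.cong[OF refl] sum.swap)
    also have "\<dots> = (\<Sum>S\<in>?M. \<Sum>T\<in>?M. \<Sum>U\<in>?M. \<Sum>V\<in>?M.
          smul B (t T * u U * gram B l T U * (s S * v V)) (cbas B l S V))"
      by (rule sum.swap)
    finally show ?thesis by (simp only: scale_scale ac_simps)
  qed
  ultimately have "pure l s t * pure l u v - smul B (cell_form B l t u) (pure l s v) =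
      (\<Sum>S\<in>?M. \<Sum>T\<in>?M. \<Sum>U\<in>?M. \<Sum>V\<in>?M. smul B (?k S T U V)
        (cbas B l S T * cbas B l U V - smul B (gram B l T U) (cbas B l S V)))"
    by (simp only: scale_right_diff_distrib sum_subtractf)
  also have "\<dots> \<in> B_less B l"
    by (intro subspace_sum[OF B_less_subspace] subspace_scale[OF B_less_subspace] gram_cbas[OF l])
  finally show ?thesis .
qed

lemma cell_act_pure:
  assumes "l \<in> cpos B" "s \<in> cell_module B l"
  shows "cell_act B l (pure l s t) u = fscale (cell_form B l t u) s"
  using assms
  by (intro cell_act_eqI)
     (auto simp: pure_mult_pure pure_scale_left fun_space.subspace_scale[OF cell_module_subspace])

lemma cell_form_add_left: "cell_form B l (x + y) z = cell_form B l x z + cell_form B l y z"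
  and cell_form_diff_left: "cell_form B l (x - y) z = cell_form B l x z - cell_form B l y z"
  and cell_form_scale_left: "cell_form B l (fscale c x) z = c * cell_form B l x z"
  and cell_form_scale_right: "cell_form B l z (fscale c x) = c * cell_form B l z x"
  and cell_form_add_right: "cell_form B l z (x + y) = cell_form B l z x + cell_form B l z y"
  by (auto simp: cell_form_def algebra_simps sum.distrib sum_subtractf sum_distrib_left)

lemma cell_form_zero_left: "cell_form B l 0 z = 0"
  and cell_form_zero_right: "cell_form B l z 0 = 0"
  by (simp_all add: cell_form_def)

lemma cell_form_sum_right: "cell_form B l z (\<Sum>i\<in>A. f i) = (\<Sum>i\<in>A. cell_form B l z (f i))"
  by (induction A rule: infinite_finite_induct)
     (simp_all only: sum.infinite sum.empty sum.insert cell_form_add_right cell_form_zero_right not_False_eq_True)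

text \<open>
  Any basis vector \<open>S\<close> serves to read the form off a product of algebra elements.
\<close>

lemma cell_form_coord:
  assumes "l \<in> cpos B" "S \<in> tab B l"
  shows "cell_form B l x y = coord (pure l (indic S) x * pure l y (indic S)) l S S"
proof -
  have idx: "(l, S, S) \<in> cell_index B" using assms by (simp add: cell_index_def)
  have "coord (pure l (indic S) x * pure l y (indic S)) l S S =
      coord (smul B (cell_form B l x y) (pure l (indic S) (indic S))) l S S"
    by (rule coord_cong[OF pure_mult_pure[OF assms(1)] idx])
  then show ?thesis
    using assms(1) idx by (simp add: coord_cell_map tensor_def indic_def)
qed

lemma cell_form_sym:
  assumes l: "l \<in> cpos B"
  shows "cell_form B l x y = cell_form B l y x"
proof (cases "tab B l = {}")
  case False
  then obtain S where S: "S \<in> tab B l" by blast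
  have "coord (invol B (pure l (indic S) x * pure l y (indic S))) l S S =
      coord (pure l (indic S) x * pure l y (indic S)) l S S"
    using l S by (simp add: coord_invol cell_index_def)
  then show ?thesis
    using l S by (simp add: invol_mult invol_pure cell_form_coord)
qed (simp add: cell_form_def)

text \<open>
  Both sides are the leading coefficient of \<open>C(s \<otimes> x) a\<^sup>* C(y \<otimes> s)\<close>, bracketed in the two ways.
\<close>

lemma cell_form_adjoint:
  assumes l: "l \<in> cpos B"
  shows "cell_form B l (cell_act B l a x) y = cell_form B l x (cell_act B l (invol B a) y)"
proof (cases "tab B l = {}")
  case False
  then obtain S where S: "S \<in> tab B l" by blast
  then have idx: "(l, S, S) \<in> cell_index B" using l by (simp add: cell_index_def)
  have "coord (pure l (indic S) x * invol B a * pure l y (indic S)) l S S =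
      coord (pure l (indic S) (cell_act B l a x) * pure l y (indic S)) l S S"
    using B_less_mult_right[OF pure_mult[OF l, of "indic S" x "invol B a"], of "pure l y (indic S)"]
    by (intro coord_cong[OF _ idx]) (simp add: left_diff_distrib invol_invol)
  moreover have "coord (pure l (indic S) x * (invol B a * pure l y (indic S))) l S S =
      coord (pure l (indic S) x * pure l (cell_act B l (invol B a) y) (indic S)) l S S"
    using B_less_mult_left[OF mult_pure[OF l, of "invol B a" y "indic S"], of "pure l (indic S) x"]
    by (intro coord_cong[OF _ idx]) (simp add: right_diff_distrib)
  ultimately show ?thesis
    by (simp add: cell_form_coord[OF l S] mult.assoc)
qed (simp add: cell_form_def)

lemma cell_rad_subspace: "fun_space.subspace (cell_rad B l)"
  using cell_module_subspace
  by (auto simp: cell_rad_def fun_space.subspace_def cell_form_add_left cell_form_scale_left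
      cell_form_zero_left)

lemma cell_act_in_cell_rad:
  assumes l: "l \<in> cpos B" and z: "z \<in> cell_rad B l"
  shows "cell_act B l a z \<in> cell_rad B l"
  using z by (auto simp: cell_rad_def cell_act_in_cell_module cell_form_adjoint[OF l])

section \<open>The Jacobson radical of a cellular algebra\<close>

text \<open>
  The condition \<open>a W(\<lambda>) \<subseteq> R(\<lambda>)\<close> says that \<open>a\<close> annihilates \<open>L(\<lambda>)\<close>, without mention of cosets.
\<close>

definition rad_ideal :: "'b set" where
  "rad_ideal = {a. \<forall>l\<in>cpos B. \<forall>x\<in>cell_module B l. cell_act B l a x \<in> cell_rad B l}"

lemma cell_rad_zero: "0 \<in> cell_rad B l"
  by (rule fun_space.subspace_0[OF cell_rad_subspace])

lemma rad_ideal_subspace: "subspace rad_ideal"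
  using cell_rad_subspace
  by (auto simp: subspace_def rad_ideal_def fun_space.subspace_def cell_act_add cell_act_scale)
     (metis cell_act_diff cell_rad_zero diff_self)

lemma rad_ideal_mult_left: "x \<in> rad_ideal \<Longrightarrow> a * x \<in> rad_ideal"
  by (auto simp: rad_ideal_def cell_act_mult cell_act_in_cell_rad)

text \<open>
  By adjointness and symmetry \<open>\<phi>(a\<^sup>* x, y) = \<phi>(a y, x)\<close>.
\<close>

lemma rad_ideal_invol:
  assumes "a \<in> rad_ideal"
  shows "invol B a \<in> rad_ideal"
proof -
  have "cell_form B l (cell_act B l (invol B a) x) y = 0"
    if l: "l \<in> cpos B" and xy: "x \<in> cell_module B l" "y \<in> cell_module B l" for l x y
  proof -
    have "cell_form B l (cell_act B l (invol B a) x) y = cell_form B l (cell_act B l a y) x"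
      using cell_form_adjoint[OF l, of "invol B a" x y] cell_form_sym[OF l, of x]
      by (simp add: invol_invol)
    then show ?thesis using assms that by (auto simp: rad_ideal_def cell_rad_def)
  qed
  then show ?thesis by (auto simp: rad_ideal_def cell_rad_def cell_act_in_cell_module)
qed

definition column :: "'l \<Rightarrow> 'b \<Rightarrow> 'm \<Rightarrow> 'm \<Rightarrow> 'f" where
  "column l b T = (\<lambda>S. if S \<in> tab B l then coord b l S T else 0)"

lemma column_in_cell_module: "column l b T \<in> cell_module B l"
  by (simp add: column_def cell_module_def)

text \<open>
  The expansion runs along the second index, so that left multiplication acts on the first factors
  of the pure elements; this is what the cell action describes.
\<close>

lemma top_layer:
  assumes b: "b \<in> cell_span I" and m: "m \<in> cpos B"
  shows "b - (\<Sum>T\<in>tab B m. pure m (column m b T) (indic T)) \<in> cell_span (I - {m})"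
  unfolding mem_cell_span_iff
proof (intro allI impI)
  fix k U V assume k: "(k, U, V) \<in> cell_index B" "k \<notin> I - {m}"
  have "(\<Sum>T\<in>tab B m. coord (pure m (column m b T) (indic T)) k U V) =
      (\<Sum>T\<in>tab B m. if T = V \<and> k = m then coord b m U V else 0)"
    using k(1) m
    by (intro sum.cong) (auto simp: coord_cell_map tensor_def indic_def cell_index_def column_def)
  also have "\<dots> = (if k = m then coord b k U V else 0)"
    using k(1) finite_tab[OF m] by (auto simp: cell_index_def)
  finally show "coord (b - (\<Sum>T\<in>tab B m. pure m (column m b T) (indic T))) k U V = 0"
    using k b by (auto simp: coord_sum mem_cell_span_iff)
qed

text \<open>
  For \<open>b = C(s \<otimes> t)\<close> and \<open>c = C(u \<otimes> v)\<close> the product \<open>b a c\<close> is \<open>\<phi>(t, a u) C(s \<otimes> v)\<close> modulo lower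
  cells, and \<open>a u\<close> lies in the radical of the form.
\<close>

lemma sandwich_in_lower_cells:
  assumes I: "down_set I" "m \<in> I" "down_set (I - {m})"
    and b: "b \<in> cell_span I" and c: "c \<in> cell_span I" and a: "a \<in> rad_ideal"
  shows "b * a * c \<in> cell_span (I - {m})"
proof -
  let ?K = "cell_span (I - {m})"
  have m: "m \<in> cpos B" using I(1,2) by (auto simp: down_set_def)
  note diff = subspace_diff[OF cell_span_subspace] and add = subspace_add[OF cell_span_subspace]
  \<comment> \<open>The left factor has to be expanded along its first index, hence the detour through \<open>b\<^sup>*\<close>.\<close>
  have "invol B b - (\<Sum>S\<in>tab B m. pure m (column m (invol B b) S) (indic S)) \<in> ?K" (is "_ - ?b' \<in> _")
    using top_layer[OF invol_in_cell_span[OF b] m] .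
  then have b': "b - invol B ?b' \<in> ?K"
    using invol_in_cell_span[of "invol B b - ?b'"] by (simp add: invol_diff invol_invol)
  have b'_eq: "invol B ?b' = (\<Sum>S\<in>tab B m. pure m (indic S) (column m (invol B b) S))"
    using m by (simp add: invol_sum invol_pure)
  have c': "c - (\<Sum>T\<in>tab B m. pure m (column m c T) (indic T)) \<in> ?K" (is "_ - ?c' \<in> _")
    by (rule top_layer[OF c m])
  have pure_sandwich: "pure m s t * a * pure m u v \<in> ?K" if u: "u \<in> cell_module B m" and t: "t \<in> cell_module B m"
    for s t u v
  proof -
    let ?au = "cell_act B m a u"
    have "?au \<in> cell_rad B m" using a u m by (auto simp: rad_ideal_def)
    then have "cell_form B m t ?au = 0"
      using t m by (auto simp: cell_rad_def cell_form_sym[of m t])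
    then have 1: "pure m s t * pure m ?au v \<in> B_less B m"
      using pure_mult_pure[OF m, of s t ?au v] by simp
    have "pure m s t * (a * pure m u v - pure m ?au v) \<in> B_less B m"
      by (rule B_less_mult_left[OF mult_pure[OF m]])
    from subspace_add[OF B_less_subspace this 1] have "pure m s t * a * pure m u v \<in> B_less B m"
      by (simp add: algebra_simps)
    then show ?thesis using B_less_subset[OF I(1,2)] by blast
  qed
  then have "invol B ?b' * a * ?c' \<in> ?K"
    unfolding b'_eq sum_distrib_right sum_distrib_left
    by (intro subspace_sum[OF cell_span_subspace]) (auto intro!: pure_sandwich column_in_cell_module)
  moreover have "(b - invol B ?b') * (a * c) \<in> ?K"
    by (rule cell_span_mult_right[OF I(3) b'])
  moreover have "(invol B ?b' * a) * (c - ?c') \<in> ?K"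
    by (rule cell_span_mult_left[OF I(3) c'])
  ultimately have "(b - invol B ?b') * (a * c) + ((invol B ?b' * a) * (c - ?c') + invol B ?b' * a * ?c') \<in> ?K"
    by (intro add)
  then show ?thesis
    by (simp only: left_diff_distrib right_diff_distrib mult.assoc) simp
qed

text \<open>
  The cube of \<open>a\<close> lies in a smaller cell ideal, and \<open>1 - a\<^sup>3 = (1 + a + a\<^sup>2)(1 - a)\<close>, so a left
  inverse of \<open>1 - a\<^sup>3\<close> yields one of \<open>1 - a\<close>.
\<close>

lemma rad_ideal_left_inverse:
  assumes "down_set I" "a \<in> rad_ideal" "a \<in> cell_span I"
  shows "\<exists>b. b * (unit_element - a) = unit_element"
  using assms
proof (induction I arbitrary: a rule: down_set_induct)
  case empty
  then have "a = 0" by (simp add: cell_span_empty)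
  then show ?case by (intro exI[of _ unit_element]) simp
next
  case (step I m)
  have "a * a * a \<in> cell_span (I - {m})"
    using step by (intro sandwich_in_lower_cells)
  moreover have "a * a * a \<in> rad_ideal" using step by (intro rad_ideal_mult_left)
  ultimately obtain b where "b * (unit_element - a * a * a) = unit_element"
    using step.IH by blast
  then have "(b * (unit_element + a + a * a)) * (unit_element - a) = unit_element"
    by (simp add: algebra_simps)
  then show ?case by blast
qed

text \<open>
  One inclusion holds because all elements of \<open>rad_ideal\<close> are quasi-regular. For the other, if \<open>a\<close>
  is in the Jacobson radical and \<open>\<phi>(a x, y) \<noteq> 0\<close>, then for a suitable multiple \<open>b\<close> of \<open>C(x \<otimes> y)\<close> the
  element \<open>b a\<close> fixes \<open>x \<noteq> 0\<close>, although \<open>1 - b a\<close> is left invertible.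
\<close>

theorem jacobson_radical_eq_rad_ideal: "jacobson_radical (smul B) = rad_ideal"
proof
  show "rad_ideal \<subseteq> jacobson_radical (smul B)"
  proof (rule quasi_regular_left_ideal_subset_jacobson_radical)
    show "left_ideal (smul B) rad_ideal"
      by (simp add: left_ideal_def rad_ideal_subspace rad_ideal_mult_left)
    have "down_set (cpos B)" by (simp add: down_set_def)
    then show "\<exists>b. b * (unit_element - a) = unit_element" if "a \<in> rad_ideal" for a
      using that by (rule rad_ideal_left_inverse[OF _ _ cell_span_cpos])
  qed
next
  have "cell_form B l (cell_act B l a x) y = 0"
    if a: "a \<in> jacobson_radical (smul B)" and l: "l \<in> cpos B"
      and x: "x \<in> cell_module B l" for a l x y
  proof (rule ccontr)
    let ?p = "cell_form B l (cell_act B l a x) y"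
    assume nz: "?p \<noteq> 0"
    define b where "b = smul B (1 / ?p) (pure l x y)"
    have "cell_act B l (b * a) x = fscale (1 / ?p) (fscale (cell_form B l y (cell_act B l a x)) x)"
      unfolding b_def using l x by (simp only: cell_act_mult cell_act_scale cell_act_pure)
    then have "cell_act B l (b * a) x = x"
      using nz cell_form_sym[OF l, of y] by (simp add: fun_eq_iff)
    then have fixed: "cell_act B l (unit_element - b * a) x = 0"
      using l x by (simp add: cell_act_diff cell_act_unit)
    have "b * a \<in> jacobson_radical (smul B)"
      using a left_ideal_jacobson_radical by (auto simp: left_ideal_def)
    then obtain d where "d * (unit_element - b * a) = unit_element"
      using jacobson_radical_left_inverse by blast
    then have "x = cell_act B l (d * (unit_element - b * a)) x"
      using l x by (simp add: cell_act_unit)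
    also have "\<dots> = 0" using l fixed by (simp add: cell_act_mult cell_act_zero_vec)
    finally show False using nz by (simp add: cell_act_zero_vec cell_form_zero_left)
  qed
  then show "jacobson_radical (smul B) \<subseteq> rad_ideal"
    by (auto simp: rad_ideal_def cell_rad_def cell_act_in_cell_module)
qed

section \<open>Elements acting as the identity on the quotients \<open>L(\<lambda>)\<close>\<close>

text \<open>
  If \<open>G\<close> is a linear generalised inverse of the map \<open>\<Phi>\<close> given by the Gram matrix, so that
  \<open>\<Phi> G \<Phi> = \<Phi>\<close>, then the element of the cell with matrix \<open>G\<close> acts on \<open>W(\<lambda>)\<close> as \<open>G \<Phi>\<close>, which is
  the identity modulo the kernel \<open>R(\<lambda>)\<close> of \<open>\<Phi>\<close>.
\<close>

lemma ex_cell_identity: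
  assumes l: "l \<in> cpos B"
  shows "\<exists>g\<in>cell_span {l}. \<forall>x\<in>cell_module B l. cell_act B l g x - x \<in> cell_rad B l"
proof -
  let ?W = "cell_module B l"
  define Phi :: "('m \<Rightarrow> 'f) \<Rightarrow> 'm \<Rightarrow> 'f"
    where "Phi w = (\<lambda>T. if T \<in> tab B l then cell_form B l (indic T) w else 0)" for w
  interpret pair: vector_space_pair "fscale :: 'f \<Rightarrow> ('m \<Rightarrow> 'f) \<Rightarrow> 'm \<Rightarrow> 'f"
    "fscale :: 'f \<Rightarrow> ('m \<Rightarrow> 'f) \<Rightarrow> 'm \<Rightarrow> 'f" ..
  have "Vector_Spaces.linear fscale fscale Phi"
    by unfold_locales (auto simp: Phi_def cell_form_add_right cell_form_scale_right)
  then obtain G where G: "G ` UNIV \<subseteq> ?W" "Vector_Spaces.linear fscale fscale G"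
      "\<forall>v\<in>Phi ` ?W. Phi (G v) = v"
    using pair.linear_exists_right_inverse_on[OF _ cell_module_subspace] by blast
  interpret G: Vector_Spaces.linear fscale fscale G by (rule G(2))
  define g where "g = (\<Sum>T\<in>tab B l. pure l (G (indic T)) (indic T))"
  have act_g: "cell_act B l g x = G (Phi x)" if x: "x \<in> ?W" for x
  proof -
    have "cell_act B l g x = (\<Sum>T\<in>tab B l. cell_act B l (pure l (G (indic T)) (indic T)) x)"
      unfolding g_def by (rule cell_act_sum[OF l])
    also have "\<dots> = (\<Sum>T\<in>tab B l. fscale (Phi x T) (G (indic T)))"
      using l G(1) by (intro sum.cong) (auto simp: Phi_def intro!: cell_act_pure)
    also have "\<dots> = G (\<Sum>T\<in>tab B l. fscale (Phi x T) (indic T))"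
      by (simp add: G.sum G.scale)
    also have "\<dots> = G (Phi x)"
      by (subst (2) cell_module_expansion[OF l]) (auto simp: cell_module_def Phi_def)
    finally show ?thesis .
  qed
  have "cell_act B l g x - x \<in> cell_rad B l" if x: "x \<in> ?W" for x
  proof -
    have GPhi: "Phi (G (Phi x)) = Phi x" using G(3) x by blast
    have indic: "cell_form B l (G (Phi x) - x) (indic T) = 0" if "T \<in> tab B l" for T
      using fun_cong[OF GPhi, of T] that
      by (simp add: Phi_def cell_form_diff_left cell_form_sym[OF l, of "indic T"])
    have "cell_form B l (G (Phi x) - x) y = 0" if "y \<in> ?W" for y
    proof -
      have "cell_form B l (G (Phi x) - x) (\<Sum>T\<in>tab B l. fscale (y T) (indic T)) = 0"
        by (simp add: cell_form_sum_right cell_form_scale_right indic)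
      then show ?thesis using cell_module_expansion[OF l that] by simp
    qed
    moreover have "G (Phi x) - x \<in> ?W"
      using G(1) x by (auto intro: fun_space.subspace_diff[OF cell_module_subspace])
    ultimately show ?thesis by (simp add: act_g[OF x] cell_rad_def)
  qed
  moreover have "g \<in> cell_span {l}"
    unfolding g_def mem_cell_span_iff using l by (auto simp: coord_sum coord_cell_map)
  ultimately show ?thesis by blast
qed

text \<open>
  With \<open>g\<close> for the top cell \<open>m\<close> and \<open>f\<close> for the remaining ones, \<open>1 - (1 - f)(1 - g)\<close> serves for the
  union, because \<open>f\<close> annihilates \<open>W(m)\<close>.
\<close>

lemma ex_identity_on_quotients:
  assumes "down_set I"
  shows "\<exists>f\<in>cell_span I. \<forall>l\<in>I. \<forall>x\<in>cell_module B l. cell_act B l f x - x \<in> cell_rad B l"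
  using assms
proof (induction I rule: down_set_induct)
  case empty
  show ?case using subspace_0[OF cell_span_subspace] by blast
next
  case (step I m)
  note diff = subspace_diff[OF cell_span_subspace] and add = subspace_add[OF cell_span_subspace]
  have m: "m \<in> cpos B" using step.hyps(1,2) by (auto simp: down_set_def)
  obtain f where f: "f \<in> cell_span (I - {m})"
      "\<And>l x. l \<in> I - {m} \<Longrightarrow> x \<in> cell_module B l \<Longrightarrow> cell_act B l f x - x \<in> cell_rad B l"
    using step.IH by blast
  obtain g where g: "g \<in> cell_span {m}"
      "\<And>x. x \<in> cell_module B m \<Longrightarrow> cell_act B m g x - x \<in> cell_rad B m"
    using ex_cell_identity[OF m] by blast
  have in_I: "f \<in> cell_span I" "g \<in> cell_span I"
    using f(1) g(1) step.hyps(2) cell_span_mono[of "I - {m}" I] cell_span_mono[of "{m}" I] by auto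
  have "f + g - f * g \<in> cell_span I"
    using in_I by (intro diff add cell_span_mult_left[OF step.hyps(1)])
  moreover have "cell_act B l (f + g - f * g) x - x \<in> cell_rad B l"
    if l: "l \<in> I" and x: "x \<in> cell_module B l" for l x
  proof -
    have lB: "l \<in> cpos B" using l step.hyps(1) by (auto simp: down_set_def)
    have act: "cell_act B l (f + g - f * g) x - x =
        (cell_act B l f x + cell_act B l g x - cell_act B l f (cell_act B l g x)) - x"
      using lB by (simp add: cell_act_diff cell_act_add cell_act_mult)
    show ?thesis
    proof (cases "l = m")
      case True
      have "cell_act B l f y = 0" for y
        using cell_act_eq_zero[OF step.hyps(3) f(1) lB] True by simp
      then show ?thesis using act g(2) x True by simp
    next
      case False
      have "(cell_act B l f x - x) - (cell_act B l f (cell_act B l g x) - cell_act B l g x)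
          \<in> cell_rad B l"
        using l False x
        by (intro fun_space.subspace_diff[OF cell_rad_subspace f(2) f(2)] cell_act_in_cell_module)
           auto
      then show ?thesis unfolding act by (simp add: algebra_simps)
    qed
  qed
  ultimately show ?case by blast
qed

section \<open>Lifting leading terms into the radical\<close>

text \<open>
  Let \<open>f \<in> B(<l)\<close> act as the identity on the quotients \<open>L(m)\<close> with \<open>m < l\<close>. Then \<open>(1 - f) j\<close> annihilates
  these \<open>L(m)\<close> and has the same leading term as \<open>j\<close>. It annihilates \<open>L(l)\<close> because \<open>C(z \<otimes> x)\<close> maps
  \<open>W(l)\<close> into the line of \<open>z \<in> R(l)\<close>, and it annihilates \<open>W(m)\<close> for all other \<open>m\<close> because it lies in
  \<open>B(\<le>l)\<close>. The lift is given as \<open>j - f j\<close> so that it belongs to every left ideal containing \<open>j\<close>.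
\<close>

lemma ex_radical_lift:
  assumes l: "l \<in> cpos B" and z: "z \<in> cell_rad B l"
    and j: "j - pure l z x \<in> B_less B l"
  shows "\<exists>f. j - f * j \<in> rad_ideal \<and> (j - f * j) - pure l z x \<in> B_less B l"
proof -
  let ?I = "{m \<in> cpos B. m < l}"
  obtain f where f: "f \<in> cell_span ?I"
      "\<And>m x. m \<in> ?I \<Longrightarrow> x \<in> cell_module B m \<Longrightarrow> cell_act B m f x - x \<in> cell_rad B m"
    using ex_identity_on_quotients[OF down_set_less] by blast
  have "f * j \<in> B_less B l"
    unfolding B_less_eq_cell_span by (rule cell_span_mult_right[OF down_set_less f(1)])
  from subspace_diff[OF B_less_subspace j this]
  have lead: "(j - f * j) - pure l z x \<in> B_less B l" by (simp add: algebra_simps)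
  have "cell_act B m (j - f * j) y \<in> cell_rad B m"
    if m: "m \<in> cpos B" and y: "y \<in> cell_module B m" for m y
  proof -
    let ?d = "(j - f * j) - pure l z x"
    have split: "cell_act B m (j - f * j) y = cell_act B m ?d y + cell_act B m (pure l z x) y"
      using cell_act_add[OF m, of ?d "pure l z x" y] by simp
    consider "m < l" | "m = l" | "\<not> m \<le> l" by fastforce
    then show ?thesis
    proof cases
      case 1
      have "0 - (cell_act B m f (cell_act B m j y) - cell_act B m j y) \<in> cell_rad B m"
        using 1 m by (intro fun_space.subspace_diff[OF cell_rad_subspace cell_rad_zero]
            f(2) cell_act_in_cell_module) simp
      then show ?thesis using m by (simp add: cell_act_diff cell_act_mult)
    next
      case 2
      have "cell_act B l ?d y = 0"
        using cell_act_eq_zero[OF down_set_less lead[unfolded B_less_eq_cell_span] l] by simp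
      moreover have "cell_act B l (pure l z x) y \<in> cell_rad B l"
        using z l by (auto simp: cell_rad_def cell_act_pure cell_form_scale_left
            fun_space.subspace_scale[OF cell_module_subspace])
      ultimately show ?thesis using split 2 by simp
    next
      case 3
      have down: "down_set {m \<in> cpos B. m \<le> l}" by (auto simp: down_set_def)
      have "pure l z x \<in> cell_span {m \<in> cpos B. m \<le> l}"
        using l by (auto simp: mem_cell_span_iff coord_cell_map)
      moreover have "?d \<in> cell_span {m \<in> cpos B. m \<le> l}"
        by (rule subsetD[OF cell_span_mono lead[unfolded B_less_eq_cell_span]]) auto
      ultimately have "cell_act B m ?d y = 0" "cell_act B m (pure l z x) y = 0"
        using cell_act_eq_zero[OF down _ m] 3 by auto
      then show ?thesis using split by (simp add: cell_rad_zero)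
    qed
  qed
  then show ?thesis using lead by (auto simp: rad_ideal_def)
qed

lemma invol_lift:
  assumes "l \<in> cpos B" "r - pure l z x \<in> B_less B l"
  shows "invol B r - pure l x z \<in> B_less B l"
  using assms invol_in_cell_span[of "r - pure l z x"]
  by (simp add: B_less_eq_cell_span invol_diff invol_pure)

lemma ex_radical_element:
  assumes l: "l \<in> cpos B" and z: "z \<in> cell_rad B l"
  shows "\<exists>r\<in>rad_ideal. r - pure l z x \<in> B_less B l"
    and "\<exists>r\<in>rad_ideal. r - pure l x z \<in> B_less B l"
proof -
  have "pure l z x - pure l z x \<in> B_less B l"
    by (simp add: subspace_0[OF B_less_subspace])
  then obtain r where r: "r \<in> rad_ideal" "r - pure l z x \<in> B_less B l"
    using ex_radical_lift[OF l z] by blast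
  then show "\<exists>r\<in>rad_ideal. r - pure l z x \<in> B_less B l" by blast
  show "\<exists>r\<in>rad_ideal. r - pure l x z \<in> B_less B l"
    using rad_ideal_invol[OF r(1)] invol_lift[OF l r(2)] by blast
qed

section \<open>Spanning the radical\<close>

text \<open>
  If \<open>f\<close> acts as the identity on the quotients, then in
  \<open>a = (a - f a) + (f a - f a f\<^sup>*) + f a f\<^sup>*\<close> the first two terms have leading terms that are sums of
  \<open>C(z \<otimes> x)\<close> and of \<open>C(x \<otimes> z)\<close> with \<open>z\<close> in the radical of the form, and the third one has none.
\<close>

lemma radical_spanned_by_lifts:
  assumes X: "\<And>l x z. l \<in> cpos B \<Longrightarrow> x \<in> cell_module B l \<Longrightarrow> z \<in> cell_rad B l \<Longrightarrow>
      (\<exists>r\<in>X. r \<in> rad_ideal \<and> r - pure l x z \<in> B_less B l) \<and>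
      (\<exists>r\<in>X. r \<in> rad_ideal \<and> r - pure l z x \<in> B_less B l)"
  shows "rad_ideal \<subseteq> span X"
proof -
  have "a \<in> span X" if "down_set I" "a \<in> rad_ideal" "a \<in> cell_span I" for I a
    using that
  proof (induction I arbitrary: a rule: down_set_induct)
    case empty
    then have "a = 0" by (simp add: cell_span_empty)
    then show ?case by (simp add: span_zero)
  next
    case (step I m)
    let ?K = "cell_span (I - {m})"
    have m: "m \<in> cpos B" using step.hyps(1,2) by (auto simp: down_set_def)
    obtain f where f: "f \<in> cell_span I"
      "\<And>l x. l \<in> I \<Longrightarrow> x \<in> cell_module B l \<Longrightarrow> cell_act B l f x - x \<in> cell_rad B l"
      using ex_identity_on_quotients[OF step.hyps(1)] by blast
    define z where "z b T = column m b T - cell_act B m f (column m b T)" for b T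
    have z: "z b T \<in> cell_rad B m" for b T
    proof -
      have "0 - (cell_act B m f (column m b T) - column m b T) \<in> cell_rad B m"
        by (intro fun_space.subspace_diff[OF cell_rad_subspace cell_rad_zero]
            f(2)[OF step.hyps(2)] column_in_cell_module)
      then show ?thesis by (simp add: z_def)
    qed
    have lead: "(b - f * b) - (\<Sum>T\<in>tab B m. pure m (z b T) (indic T)) \<in> ?K"
      if b: "b \<in> cell_span I" for b
    proof -
      let ?b = "\<Sum>T\<in>tab B m. pure m (column m b T) (indic T)"
      let ?fb = "\<Sum>T\<in>tab B m. pure m (cell_act B m f (column m b T)) (indic T)"
      have b': "b - ?b \<in> ?K" by (rule top_layer[OF b m])
      have "f * ?b - ?fb = (\<Sum>T\<in>tab B m. f * pure m (column m b T) (indic T) -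
          pure m (cell_act B m f (column m b T)) (indic T))"
        by (simp only: sum_distrib_left sum_subtractf)
      also have "\<dots> \<in> B_less B m"
        by (intro subspace_sum[OF B_less_subspace] mult_pure[OF m])
      finally have "f * ?b - ?fb \<in> ?K" using B_less_subset[OF step.hyps(1,2)] by blast
      from subspace_add[OF cell_span_subspace cell_span_mult_left[OF step.hyps(3) b', of f] this]
      have "(b - ?b) - (f * (b - ?b) + (f * ?b - ?fb)) \<in> ?K"
        by (rule subspace_diff[OF cell_span_subspace b'])
      moreover have "(\<Sum>T\<in>tab B m. pure m (z b T) (indic T)) = ?b - ?fb"
        by (simp only: z_def pure_diff_left[OF m] sum_subtractf)
      ultimately show ?thesis by (simp only: right_diff_distrib) (simp add: algebra_simps)
    qed
    define r where "r z T = (SOME r. r \<in> X \<and> r \<in> rad_ideal \<and> r - pure m z (indic T) \<in> B_less B m)"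
      for z T
    define r' where "r' z T = (SOME r. r \<in> X \<and> r \<in> rad_ideal \<and> r - pure m (indic T) z \<in> B_less B m)"
      for z T
    have r: "r z T \<in> X \<and> r z T \<in> rad_ideal \<and> r z T - pure m z (indic T) \<in> B_less B m"
      and r': "r' z T \<in> X \<and> r' z T \<in> rad_ideal \<and> r' z T - pure m (indic T) z \<in> B_less B m"
      if "z \<in> cell_rad B m" "T \<in> tab B m" for z T
    proof -
      note X' = X[OF m indic_in_cell_module[OF that(2)] that(1)]
      then have "\<exists>r. r \<in> X \<and> r \<in> rad_ideal \<and> r - pure m z (indic T) \<in> B_less B m" by blast
      from someI_ex[OF this]
      show "r z T \<in> X \<and> r z T \<in> rad_ideal \<and> r z T - pure m z (indic T) \<in> B_less B m"
        unfolding r_def .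
      from X' have "\<exists>r. r \<in> X \<and> r \<in> rad_ideal \<and> r - pure m (indic T) z \<in> B_less B m" by blast
      from someI_ex[OF this]
      show "r' z T \<in> X \<and> r' z T \<in> rad_ideal \<and> r' z T - pure m (indic T) z \<in> B_less B m"
        unfolding r'_def .
    qed
    define s where "s = (\<Sum>T\<in>tab B m. r (z a T) T)"
    \<comment> \<open>The involution turns \<open>f a - f a f\<^sup>*\<close> into \<open>c - f c\<close>.\<close>
    define c where "c = invol B (f * a)"
    define s' where "s' = (\<Sum>T\<in>tab B m. r' (z c T) T)"
    have s: "s \<in> span X" "s \<in> rad_ideal" "s' \<in> span X" "s' \<in> rad_ideal"
      unfolding s_def s'_def
      using r[OF z] r'[OF z] by (auto intro: span_sum[OF span_base] subspace_sum[OF rad_ideal_subspace])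
    have c: "c \<in> cell_span I"
      unfolding c_def using step by (intro invol_in_cell_span cell_span_mult_left)
    have "s - (\<Sum>T\<in>tab B m. pure m (z a T) (indic T)) \<in> ?K"
      unfolding s_def sum_subtractf[symmetric]
      using r[OF z] B_less_subset[OF step.hyps(1,2)] by (intro subspace_sum[OF cell_span_subspace]) blast
    from subspace_diff[OF cell_span_subspace lead[OF step.prems(2)] this]
    have first: "(a - f * a) - s \<in> ?K" by simp
    have "(\<Sum>T\<in>tab B m. invol B (r' (z c T) T) - pure m (z c T) (indic T)) \<in> ?K"
      using invol_lift[OF m] r'[OF z] B_less_subset[OF step.hyps(1,2)]
      by (intro subspace_sum[OF cell_span_subspace]) blast
    then have "invol B s' - (\<Sum>T\<in>tab B m. pure m (z c T) (indic T)) \<in> ?K"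
      unfolding s'_def by (simp only: sum_subtractf invol_sum)
    from subspace_diff[OF cell_span_subspace lead[OF c] this]
    have "(c - f * c) - invol B s' \<in> ?K" by simp
    from invol_in_cell_span[OF this]
    have second: "(f * a - f * a * invol B f) - s' \<in> ?K"
      by (simp add: c_def invol_diff invol_mult invol_invol)
    have third: "f * a * invol B f \<in> ?K"
      using step f(1) invol_in_cell_span by (intro sandwich_in_lower_cells) auto
    from subspace_add[OF cell_span_subspace subspace_add[OF cell_span_subspace first second] third]
    have "a - (s + s') \<in> ?K" by (simp add: algebra_simps)
    moreover have "a - (s + s') \<in> rad_ideal"
      using step s by (intro subspace_diff[OF rad_ideal_subspace] subspace_add[OF rad_ideal_subspace])
    ultimately have "a - (s + s') \<in> span X" using step.IH by blast
    from span_add[OF this span_add[OF s(1,3)]] show ?case by simp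
  qed
  moreover have "down_set (cpos B)" by (simp add: down_set_def)
  ultimately show ?thesis using cell_span_cpos by blast
qed

section \<open>Ideals containing the radical\<close>

text \<open>
  Choose \<open>u\<close> and \<open>v\<close> with \<open>\<phi>(u, v) \<noteq> 0\<close>. A radical element \<open>r\<close> with leading term \<open>C(z \<otimes> u)\<close> lies in \<open>J\<close>
  and maps \<open>v\<close> to \<open>\<phi>(u, v) z\<close>.
\<close>

lemma cell_rad_subset_of_radical_subset:
  assumes qh: "quasi_hereditary B" and J: "rad_ideal \<subseteq> J" and l: "l \<in> cpos B"
  shows "cell_rad B l \<subseteq> ideal_cell_module B J l"
proof
  fix z assume z: "z \<in> cell_rad B l"
  obtain u v where uv: "u \<in> cell_module B l" "v \<in> cell_module B l" "cell_form B l u v \<noteq> 0"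
    using qh l unfolding quasi_hereditary_def by blast
  obtain r where r: "r \<in> rad_ideal" "r - pure l z u \<in> B_less B l"
    using ex_radical_element(1)[OF l z] by blast
  have "cell_act B l (r - pure l z u) v = 0"
    using r(2) cell_act_eq_zero[OF down_set_less _ l] by (simp add: B_less_eq_cell_span)
  then have "cell_act B l r v = cell_act B l (pure l z u) v"
    using l by (simp add: cell_act_diff)
  also have "\<dots> = fscale (cell_form B l u v) z"
    using l z by (intro cell_act_pure) (simp_all add: cell_rad_def)
  finally have "fscale (1 / cell_form B l u v) (cell_act B l r v) = z"
    using uv by (simp add: fun_eq_iff)
  moreover have "cell_act B l r v \<in> ideal_cell_module B J l"
    unfolding ideal_cell_module_def
    by (rule fun_space.span_base) (use subsetD[OF J r(1)] uv(2) in \<open>simp, iprover\<close>)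
  then have "fscale (1 / cell_form B l u v) (cell_act B l r v) \<in> ideal_cell_module B J l"
    unfolding ideal_cell_module_def by (rule fun_space.span_scale)
  ultimately show "z \<in> ideal_cell_module B J l" by simp
qed

text \<open>
  All generators of \<open>J L(l)\<close> are then the zero coset \<open>R(l)\<close>, which the operations on cosets preserve.
\<close>

lemma annihilatedI:
  assumes l: "l \<in> cpos B"
    and zero: "\<And>a x. a \<in> J \<Longrightarrow> x \<in> cell_module B l \<Longrightarrow> cell_act B l a x \<in> cell_rad B l"
  shows "l \<in> annihilated B J"
proof -
  let ?R = "cell_rad B l"
  note sub = cell_rad_subspace[of l]
  have coset: "r +o ?R = ?R" if r: "r \<in> ?R" for r
  proof
    show "r +o ?R \<subseteq> ?R"
      using fun_space.subspace_add[OF sub r] by (auto simp: elt_set_plus_def)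
    show "?R \<subseteq> r +o ?R"
    proof
      fix y assume "y \<in> ?R"
      then have "y - r \<in> ?R" using r fun_space.subspace_diff[OF sub] by blast
      then show "y \<in> r +o ?R" by (auto simp: elt_set_plus_def intro!: bexI[of _ "y - r"])
    qed
  qed
  have R_cosets: "(\<Union>x\<in>X. g x +o ?R) = ?R" if "X \<noteq> {}" "\<And>x. x \<in> X \<Longrightarrow> g x \<in> ?R" for X g
    using that coset by auto
  have "X = ?R" if "X \<in> ideal_quot_module B J l" for X
    using that
  proof induction
    case (act a X)
    then obtain x where x: "x \<in> cell_module B l" "X = x +o ?R"
      by (auto simp: quot_module_def)
    have "x + 0 \<in> X" unfolding x(2) using cell_rad_zero by (rule set_plus_intro2)
    then have "X \<noteq> {}" by blast
    moreover have "y \<in> cell_module B l" if "y \<in> X" for y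
      using that x fun_space.subspace_add[OF cell_module_subspace]
      by (auto simp: elt_set_plus_def cell_rad_def)
    ultimately show ?case
      unfolding quot_act_def using act zero by (intro R_cosets) auto
  next
    case (add X Y)
    have "?R + ?R = ?R"
    proof
      show "?R + ?R \<subseteq> ?R"
        using fun_space.subspace_add[OF sub] by (auto simp: set_plus_def)
      show "?R \<subseteq> ?R + ?R" using cell_rad_zero by (rule set_zero_plus2)
    qed
    then show ?case using add by simp
  next
    case (scale X c)
    then show ?case
      unfolding quot_scale_def using cell_rad_zero fun_space.subspace_scale[OF sub]
      by (intro R_cosets) auto
  qed simp
  then show ?thesis
    using l ideal_quot_module.zero by (fastforce simp: annihilated_def)
qed

text \<open>
  If \<open>J L(l) \<noteq> 0\<close>, some \<open>a \<in> J\<close> satisfies \<open>\<phi>(y, a w) \<noteq> 0\<close>, and then a multiple of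
  \<open>C(z \<otimes> y) a C(w \<otimes> x)\<close> has leading term \<open>C(z \<otimes> x)\<close>. Otherwise \<open>z\<close> is, by hypothesis, a
  linear combination of vectors \<open>a w\<close> with \<open>a \<in> J\<close>, and \<open>C(z \<otimes> x)\<close> is the leading term of the same
  combination of the elements \<open>a C(w \<otimes> x)\<close>.
\<close>

lemma ex_ideal_element:
  assumes J: "two_sided_ideal (smul B) J"
    and sub: "\<And>l. l \<in> annihilated B J \<Longrightarrow> cell_rad B l \<subseteq> ideal_cell_module B J l"
    and l: "l \<in> cpos B" and z: "z \<in> cell_rad B l"
  shows "\<exists>j\<in>J. j - pure l z x \<in> B_less B l"
proof (cases "l \<in> annihilated B J")
  case True
  let ?V = "{z. \<exists>j\<in>J. j - pure l z x \<in> B_less B l}"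
  have Jsub: "subspace J" using J by (simp add: two_sided_ideal_def)
  have "fun_space.subspace ?V"
  proof (rule fun_space.subspaceI)
    show "0 \<in> ?V"
      using subspace_0[OF Jsub] subspace_0[OF B_less_subspace] by (auto simp: pure_zero_left l)
    show "y + y' \<in> ?V" if yy: "y \<in> ?V" "y' \<in> ?V" for y y'
    proof -
      obtain j j' where j: "j \<in> J" "j - pure l y x \<in> B_less B l"
          "j' \<in> J" "j' - pure l y' x \<in> B_less B l" using yy by blast
      have "(j + j') - pure l (y + y') x \<in> B_less B l"
        using subspace_add[OF B_less_subspace j(2,4)] by (simp add: pure_add_left l algebra_simps)
      then show ?thesis using subspace_add[OF Jsub j(1,3)] by blast
    qed
    show "fscale c y \<in> ?V" if y: "y \<in> ?V" for c y
    proof -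
      obtain j where j: "j \<in> J" "j - pure l y x \<in> B_less B l" using y by blast
      have "smul B c j - pure l (fscale c y) x \<in> B_less B l"
        using subspace_scale[OF B_less_subspace j(2), of c]
        by (simp add: pure_scale_left l scale_right_diff_distrib)
      then show ?thesis using subspace_scale[OF Jsub j(1)] by blast
    qed
  qed
  moreover have "cell_act B l a w \<in> ?V" if "a \<in> J" for a w
    using J that mult_pure[OF l, of a w x] by (auto simp: two_sided_ideal_def)
  ultimately have "ideal_cell_module B J l \<subseteq> ?V"
    unfolding ideal_cell_module_def by (intro fun_space.span_minimal) auto
  then show ?thesis using sub[OF True] z by blast
next
  case False
  then obtain a w where aw: "a \<in> J" "w \<in> cell_module B l" "cell_act B l a w \<notin> cell_rad B l"
    using annihilatedI[OF l] by blast
  let ?aw = "cell_act B l a w"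
  obtain y where nz: "cell_form B l y ?aw \<noteq> 0"
    using aw(3) cell_act_in_cell_module[of l a w] cell_form_sym[OF l] by (auto simp: cell_rad_def)
  let ?p = "cell_form B l y ?aw"
  let ?j = "pure l z y * a * pure l w x"
  have "pure l z y * (a * pure l w x - pure l ?aw x) \<in> B_less B l"
    by (rule B_less_mult_left[OF mult_pure[OF l]])
  from subspace_add[OF B_less_subspace this pure_mult_pure[OF l, of z y ?aw x]]
  have "?j - smul B ?p (pure l z x) \<in> B_less B l"
    by (simp add: right_diff_distrib mult.assoc)
  from subspace_scale[OF B_less_subspace this, of "1 / ?p"]
  have "smul B (1 / ?p) ?j - pure l z x \<in> B_less B l"
    using nz by (simp add: scale_right_diff_distrib)
  moreover have "smul B (1 / ?p) ?j \<in> J"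
    using J aw(1) unfolding two_sided_ideal_def by (blast intro: subspace_scale)
  ultimately show ?thesis by blast
qed

text \<open>
  The set \<open>J \<inter> rad_ideal\<close> contains an element with every leading term \<open>C(z \<otimes> x)\<close> and, through the
  involution, with every leading term \<open>C(x \<otimes> z)\<close>, so it spans the radical.
\<close>

lemma radical_subset_of_cell_rad_subset:
  assumes J: "two_sided_ideal (smul B) J" and inv: "invol B ` J = J"
    and sub: "\<And>l. l \<in> annihilated B J \<Longrightarrow> cell_rad B l \<subseteq> ideal_cell_module B J l"
  shows "rad_ideal \<subseteq> J"
proof -
  have Jsub: "subspace J" using J by (simp add: two_sided_ideal_def)
  have "(\<exists>r\<in>J \<inter> rad_ideal. r \<in> rad_ideal \<and> r - pure l x z \<in> B_less B l) \<and>
      (\<exists>r\<in>J \<inter> rad_ideal. r \<in> rad_ideal \<and> r - pure l z x \<in> B_less B l)"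
    if l: "l \<in> cpos B" and "x \<in> cell_module B l" and z: "z \<in> cell_rad B l" for l x z
  proof -
    obtain j where j: "j \<in> J" "j - pure l z x \<in> B_less B l"
      using ex_ideal_element[OF J sub l z] by blast
    obtain f where f: "j - f * j \<in> rad_ideal" "(j - f * j) - pure l z x \<in> B_less B l"
      using ex_radical_lift[OF l z j(2)] by blast
    have "j - f * j \<in> J"
      using J j(1) unfolding two_sided_ideal_def by (blast intro: subspace_diff)
    moreover from this have "invol B (j - f * j) \<in> J" using inv by blast
    ultimately show ?thesis
      using f rad_ideal_invol[OF f(1)] invol_lift[OF l f(2)] by blast
  qed
  then have "rad_ideal \<subseteq> span (J \<inter> rad_ideal)" by (rule radical_spanned_by_lifts)
  also have "\<dots> \<subseteq> J" using span_minimal[OF _ Jsub] by blast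
  finally show ?thesis .
qed

lemma mem_coset_B_less_iff: "r \<in> a +o B_less B l \<longleftrightarrow> r - a \<in> B_less B l"
  by (auto simp: elt_set_plus_def intro!: bexI[of _ "r - a"])

end

theorem theorem5p4:
  fixes B :: "('f::field, 'b::ring, 'l::order, 'm) cell_data"
  assumes "cellular_algebra B" and "quasi_hereditary B"
  shows
    "(\<forall>l\<in>cpos B. \<forall>x\<in>cell_module B l. \<forall>z\<in>cell_rad B l.
        (\<exists>r. r \<in> jacobson_radical (smul B) \<inter> (cell_map B l (x \<otimes> z) +o B_less B l)) \<and>
        (\<exists>r. r \<in> jacobson_radical (smul B) \<inter> (cell_map B l (z \<otimes> x) +o B_less B l))) \<and>
     (\<forall>X. (\<forall>l\<in>cpos B. \<forall>x\<in>cell_module B l. \<forall>z\<in>cell_rad B l.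
             (\<exists>r\<in>X. r \<in> jacobson_radical (smul B) \<inter> (cell_map B l (x \<otimes> z) +o B_less B l)) \<and>
             (\<exists>r\<in>X. r \<in> jacobson_radical (smul B) \<inter> (cell_map B l (z \<otimes> x) +o B_less B l)))
          \<longrightarrow> jacobson_radical (smul B) \<subseteq> module.span (smul B) X) \<and>
     (\<forall>J. two_sided_ideal (smul B) J \<and> invol B ` J = J \<longrightarrow>
          (jacobson_radical (smul B) \<subseteq> J \<longleftrightarrow>
             (\<forall>l\<in>annihilated B J. cell_rad B l \<subseteq> ideal_cell_module B J l)))"
proof -
  interpret cellular_algebra B by (rule assms(1))
  show ?thesis
    unfolding jacobson_radical_eq_rad_ideal Int_iff mem_coset_B_less_iff
  proof (intro conjI allI impI)
    show "\<forall>l\<in>cpos B. \<forall>x\<in>cell_module B l. \<forall>z\<in>cell_rad B l.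
        (\<exists>r. r \<in> rad_ideal \<and> r - cell_map B l (x \<otimes> z) \<in> B_less B l) \<and>
        (\<exists>r. r \<in> rad_ideal \<and> r - cell_map B l (z \<otimes> x) \<in> B_less B l)"
      using ex_radical_element unfolding Bex_def by (intro ballI conjI) iprover+
  next
    fix X
    assume "\<forall>l\<in>cpos B. \<forall>x\<in>cell_module B l. \<forall>z\<in>cell_rad B l.
        (\<exists>r\<in>X. r \<in> rad_ideal \<and> r - cell_map B l (x \<otimes> z) \<in> B_less B l) \<and>
        (\<exists>r\<in>X. r \<in> rad_ideal \<and> r - cell_map B l (z \<otimes> x) \<in> B_less B l)"
    then show "rad_ideal \<subseteq> span X" by (intro radical_spanned_by_lifts) simp
  next
    fix J assume J: "two_sided_ideal (smul B) J \<and> invol B ` J = J"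
    show "rad_ideal \<subseteq> J \<longleftrightarrow> (\<forall>l\<in>annihilated B J. cell_rad B l \<subseteq> ideal_cell_module B J l)"
    proof
      assume "rad_ideal \<subseteq> J"
      then show "\<forall>l\<in>annihilated B J. cell_rad B l \<subseteq> ideal_cell_module B J l"
        using cell_rad_subset_of_radical_subset[OF assms(2)] by (auto simp: annihilated_def)
    next
      assume "\<forall>l\<in>annihilated B J. cell_rad B l \<subseteq> ideal_cell_module B J l"
      then show "rad_ideal \<subseteq> J" using J by (intro radical_subset_of_cell_rad_subset) auto
    qed
  qed
qed

end
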